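(* Fix an integer $p\ge2$, $\lambda>0$ and $0<s<1$, and consider the multi-graph alignment problem for $p$ graphs from the correlated Erdős–Rényi model $\mathcal G(n,\lambda,s)$. Assume that $\lambda s\big(1-(1-s)^{p-1}\big)<1$. Then partial alignment is intractable: for every $0\le r<1$ and every sequence of estimators $\hat{\boldsymbol\pi}$ of $\boldsymbol\pi^*$, $\mathbb P\big(1-ov(\hat{\boldsymbol\pi},\boldsymbol\pi^* )>r\big)\to1$ as $n\to\infty$.
   Context: $E$ is the set of unordered pairs of distinct elements of $\{1,\dots,n\}$, and $\mathcal S_n$ acts on $E$ by $\sigma(\{u,v\})=\{\sigma(u),\sigma(v)\}$. Correlated Erdős–Rényi model $\mathcal G(n,\lambda,s)$: sample a master graph $G^{(0)}$ on $\{1,\dots,n\}$ in which every edge of $E$ is present independently with probability $\lambda/n$ ($n$ large); conditionally on $G^{(0)}$, the graphs $G^{(1)},\dots,G^{(p)}$ are independent random subgraphs of $G^{(0)}$, each keeping every edge of $G^{(0)}$ independently with probability $s$. Write $G_e^{(i)}=\mathbf 1_{e\in G^{(i)}}$. Alignment problem: $\boldsymbol\pi^*=(\pi_1^*=\mathrm{Id},\pi_2^*,\dots,\pi_p^* )$ where $\pi_2^*,\dots,\pi_p^*$ are i.i.d. uniform on $\mathcal S_n$, independent of the graphs. The observation is the family $\big(G^{(i)}_{(\pi_i^* )^{-1}(e)}\big)_{e\in E,\,1\le i\le p}$. An estimator is a random variable with values in $\{\mathrm{Id}\}\times\mathcal S_n^{p-1}$ which is a measurable function of the observation. Overlap: $ov(\boldsymbol\pi,\boldsymbol\pi')=\frac1n\#\{u\in\{1,\dots,n\}:\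 \pi_i(u)=\pi_i'(u)\text{ for all }2\le i\le p\}$. *)

theory Defs
  imports "HOL-Probability.Probability" "HOL-Probability.Product_PMF"
    "HOL-Combinatorics.Permutations"
begin

text \<open>
  A graph on \<open>{1..n}\<close> is represented by its edge indicator \<open>nat set \<Rightarrow> bool\<close>, which is \<open>False\<close>
  outside \<open>edges n\<close>; \<open>g e\<close> stands for \<open>g\<^sub>e = 1\<close>. Every random object lives on a finite set, so
  discrete distributions are used throughout and measurability is automatic.
\<close>

definition edges :: "nat \<Rightarrow> nat set set" where
  "edges n = {{u, v} |u v. u \<in> {1..n} \<and> v \<in> {1..n} \<and> u \<noteq> v}"

text \<open>
  \<^const>\<open>bernoulli_pmf\<close> truncates its parameter to \<open>[0, 1]\<close>, so for \<open>n < \<lambda>\<close> the master graph is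
  complete; for \<open>n \<ge> \<lambda>\<close> the parameter really is \<open>\<lambda> / n\<close>.
\<close>

definition master_graph :: "nat \<Rightarrow> real \<Rightarrow> (nat set \<Rightarrow> bool) pmf" where
  "master_graph n lam = Pi_pmf (edges n) False (\<lambda>_. bernoulli_pmf (lam / real n))"

definition random_subgraph :: "nat \<Rightarrow> real \<Rightarrow> (nat set \<Rightarrow> bool) \<Rightarrow> (nat set \<Rightarrow> bool) pmf" where
  "random_subgraph n s g =
     Pi_pmf (edges n) False (\<lambda>e. if g e then bernoulli_pmf s else return_pmf False)"

text \<open>
  The joint law of \<open>(G\<^sup>1, \<dots>, G\<^sup>p)\<close>; indices outside \<open>{1..p}\<close> carry the empty graph.
\<close>

definition correlated_ER :: "nat \<Rightarrow> nat \<Rightarrow> real \<Rightarrow> real \<Rightarrow> (nat \<Rightarrow> nat set \<Rightarrow> bool) pmf" where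
  "correlated_ER p n lam s =
     bind_pmf (master_graph n lam)
       (\<lambda>g0. Pi_pmf {1..p} (\<lambda>_. False) (\<lambda>_. random_subgraph n s g0))"

text \<open>
  The set \<open>{Id} \<times> S\<^sub>n\<^sup>p\<^sup>-\<^sup>1\<close>: a tuple is a function on indices, with value \<^const>\<open>id\<close> at index
  \<open>1\<close> and also, by convention, at the meaningless indices outside \<open>{1..p}\<close>. A permutation of
  \<open>{1..n}\<close> is a function on \<^typ>\<open>nat\<close> that is the identity outside \<open>{1..n}\<close>.
\<close>

definition alignments :: "nat \<Rightarrow> nat \<Rightarrow> (nat \<Rightarrow> nat \<Rightarrow> nat) set" where
  "alignments p n =
     {\<pi>. \<pi> 1 = id \<and> (\<forall>i\<in>{2..p}. \<pi> i permutes {1..n}) \<and> (\<forall>i. i \<notin> {1..p} \<longrightarrow> \<pi> i = id)}"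

definition random_alignment :: "nat \<Rightarrow> nat \<Rightarrow> (nat \<Rightarrow> nat \<Rightarrow> nat) pmf" where
  "random_alignment p n = Pi_pmf {2..p} id (\<lambda>_. pmf_of_set {\<sigma>. \<sigma> permutes {1..n}})"

definition alignment_model ::
  "nat \<Rightarrow> nat \<Rightarrow> real \<Rightarrow> real \<Rightarrow> ((nat \<Rightarrow> nat set \<Rightarrow> bool) \<times> (nat \<Rightarrow> nat \<Rightarrow> nat)) pmf" where
  "alignment_model p n lam s = pair_pmf (correlated_ER p n lam s) (random_alignment p n)"

text \<open>
  The observed family is indexed by \<open>1 \<le> i \<le> p\<close> and \<open>e \<in> edges n\<close> only, and is extended by
  \<open>False\<close>; the action of a permutation on edges is the image.
\<close>

definition observation ::
  "nat \<Rightarrow> nat \<Rightarrow> (nat \<Rightarrow> nat set \<Rightarrow> bool) \<Rightarrow> (nat \<Rightarrow> nat \<Rightarrow> nat) \<Rightarrow> (nat \<Rightarrow> nat set \<Rightarrow> bool)" where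
  "observation p n G \<pi> = (\<lambda>i e. i \<in> {1..p} \<and> e \<in> edges n \<and> G i (inv (\<pi> i) ` e))"

definition observations :: "nat \<Rightarrow> nat \<Rightarrow> (nat \<Rightarrow> nat set \<Rightarrow> bool) set" where
  "observations p n = {y. \<forall>i e. y i e \<longrightarrow> i \<in> {1..p} \<and> e \<in> edges n}"

definition estimators ::
  "nat \<Rightarrow> nat \<Rightarrow> ((nat \<Rightarrow> nat set \<Rightarrow> bool) \<Rightarrow> (nat \<Rightarrow> nat \<Rightarrow> nat)) set" where
  "estimators p n = observations p n \<rightarrow> alignments p n"

definition overlap :: "nat \<Rightarrow> nat \<Rightarrow> (nat \<Rightarrow> nat \<Rightarrow> nat) \<Rightarrow> (nat \<Rightarrow> nat \<Rightarrow> nat) \<Rightarrow> real" where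
  "overlap p n \<pi> \<pi>' =
     real (card {u \<in> {1..n}. \<forall>i\<in>{2..p}. \<pi> i u = \<pi>' i u}) / real n"

end

theory Submission
  imports Defs
begin

text \<open>
  It suffices to bound the expected number of vertices on which the second permutation is guessed
  correctly. Conditionally on everything but \<open>\<pi>\<^sub>2\<close>, the likelihood depends only on
  the number of edges of the intersection \<open>H\<close> of the second graph with the union of the others, and \<open>H\<close> is an
  Erdos--Renyi graph of average degree tending to \<open>\<lambda> s (1 - (1 - s)\<^sup>p\<^sup>-\<^sup>1) < 1\<close>.
  Conditionally on \<open>H\<close>, the remaining edges are independent up to the constraint that no further
  edge be shared, an event whose probability is bounded below; dropping this constraint costs a
  constant factor and makes the law invariant under automorphisms of \<open>H\<close> acting on the second
  graph and on \<open>\<pi>\<^sub>2\<close>, which the observation cannot see. Hence a vertex is guessed correctly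
  with probability at most the inverse of the size of its orbit, and the expected number of correct
  guesses is at most a constant times the expected number of orbits. That number is \<open>o(n)\<close>: vertices
  whose rooted components are isomorphic share an orbit, there are boundedly many rooted graphs of
  size at most \<open>K\<close>, and in the subcritical regime (counting self-avoiding paths) on average at most
  \<open>O(n / K)\<close> vertices lie in components larger than \<open>K\<close>.
\<close>

section \<open>Automorphism orbits of a graph\<close>

definition graph_auts :: "nat \<Rightarrow> nat set set \<Rightarrow> (nat \<Rightarrow> nat) set" where
  "graph_auts n H = {\<sigma>. \<sigma> permutes {1..n} \<and> (`) \<sigma> ` H = H}"

definition orbit :: "nat \<Rightarrow> nat set set \<Rightarrow> nat \<Rightarrow> nat set" where
  "orbit n H u = (\<lambda>\<sigma>. \<sigma> u) ` graph_auts n H"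

definition component :: "nat set set \<Rightarrow> nat \<Rightarrow> nat set" where
  "component H u = {v. (u, v) \<in> {(x, y). {x, y} \<in> H}\<^sup>*}"

lemma finite_edges [simp]: "finite (edges n)"
proof -
  have "edges n \<subseteq> Pow {1..n}"
    by (auto simp: edges_def)
  then show ?thesis
    by (rule finite_subset) simp
qed

text \<open>A crude count suffices: it only serves to keep a factor
  \<open>exp (4 * q\<^sup>2)\<close> per edge, with \<open>q = lam / n\<close>, bounded
  overall.\<close>

lemma card_edges_le: "card (edges n) \<le> n ^ 2"
proof -
  have "edges n \<subseteq> (\<lambda>(u, v). {u, v}) ` ({1..n} \<times> {1..n})"
    by (auto simp: edges_def)
  then have "card (edges n) \<le> card ((\<lambda>(u, v). {u, v}) ` ({1..n} \<times> {1..n}))"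
    by (intro card_mono) auto
  also have "\<dots> \<le> card ({1..n} \<times> {1..n})"
    by (rule card_image_le) simp
  finally show ?thesis
    by (simp add: power2_eq_square)
qed

lemma image_mem_edges:
  assumes "\<sigma> permutes {1..n}" "e \<in> edges n"
  shows "\<sigma> ` e \<in> edges n"
proof -
  obtain u v where e: "e = {u, v}" "u \<in> {1..n}" "v \<in> {1..n}" "u \<noteq> v"
    using assms(2) by (auto simp: edges_def)
  have "\<sigma> ` e = {\<sigma> u, \<sigma> v}" "\<sigma> u \<in> {1..n}" "\<sigma> v \<in> {1..n}" "\<sigma> u \<noteq> \<sigma> v"
    using e permutes_in_image[OF assms(1)] permutes_inj[OF assms(1)] by (auto simp: inj_def)
  then show ?thesis
    unfolding edges_def by blast
qed

lemma inv_image_image: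
  assumes "\<sigma> permutes V"
  shows "inv \<sigma> ` \<sigma> ` e = e" "\<sigma> ` inv \<sigma> ` e = e"
  using permutes_inverses[OF assms] by (simp_all add: image_image)

lemma image_mem_edges_iff:
  assumes "\<sigma> permutes {1..n}"
  shows "\<sigma> ` e \<in> edges n \<longleftrightarrow> e \<in> edges n"
  using image_mem_edges[OF assms, of e] image_mem_edges[OF permutes_inv[OF assms], of "\<sigma> ` e"]
  by (auto simp: inv_image_image[OF assms])

lemma finite_graph_auts [simp]: "finite (graph_auts n H)"
  unfolding graph_auts_def
  by (rule finite_subset[OF _ finite_permutations[of "{1..n}"]]) auto

lemma id_in_graph_auts: "id \<in> graph_auts n H"
  by (simp add: graph_auts_def permutes_id)

lemma graph_auts_nonempty: "graph_auts n H \<noteq> {}"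
  using id_in_graph_auts by blast

lemma graph_auts_compose:
  assumes "\<sigma> \<in> graph_auts n H" "\<tau> \<in> graph_auts n H"
  shows "\<sigma> \<circ> \<tau> \<in> graph_auts n H"
proof -
  have "(`) (\<sigma> \<circ> \<tau>) ` H = (`) \<sigma> ` (`) \<tau> ` H"
    by (simp add: image_image image_comp)
  then show ?thesis
    using assms by (auto simp: graph_auts_def intro: permutes_compose)
qed

lemma graph_auts_inv:
  assumes "\<sigma> \<in> graph_auts n H"
  shows "inv \<sigma> \<in> graph_auts n H"
proof -
  have \<sigma>: "\<sigma> permutes {1..n}" "(`) \<sigma> ` H = H"
    using assms by (auto simp: graph_auts_def)
  have "(`) (inv \<sigma>) ` H = (`) (inv \<sigma>) ` (`) \<sigma> ` H"
    using \<sigma>(2) by simp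
  also have "\<dots> = H"
    unfolding image_image[of "(`) (inv \<sigma>)"] using inv_image_image(1)[OF \<sigma>(1)] by simp
  finally show ?thesis
    using \<sigma>(1) by (simp add: graph_auts_def permutes_inv)
qed

lemma finite_orbit [simp]: "finite (orbit n H u)"
  by (simp add: orbit_def)

lemma self_in_orbit: "u \<in> orbit n H u"
  unfolding orbit_def by (rule image_eqI[OF _ id_in_graph_auts]) simp

lemma card_orbit_pos: "card (orbit n H u) > 0"
  using self_in_orbit[of u n H] card_gt_0_iff by (metis empty_iff finite_orbit)

text \<open>Orbit-stabilizer as an inequality, so that \<open>y\<close> may lie outside the orbit.
  Composing with \<open>\<tau> \<circ> inv \<sigma>0\<close> injects the automorphisms sending
  \<open>u\<close> to \<open>y\<close> into those sending \<open>u\<close> to \<open>z\<close>, for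
  each \<open>z\<close> of the orbit, and the latter classes partition the group.\<close>

lemma orbit_stabilizer_le:
  "real (card {\<sigma> \<in> graph_auts n H. \<sigma> u = y}) \<le> real (card (graph_auts n H)) / real (card (orbit n H u))"
proof -
  define F where "F z = {\<sigma> \<in> graph_auts n H. \<sigma> u = z}" for z
  have fin: "finite (F z)" for z
    by (simp add: F_def)
  have le: "card (F y) \<le> card (F z)" if z: "z \<in> orbit n H u" for z
  proof (cases "F y = {}")
    case False
    then obtain \<sigma>0 where \<sigma>0: "\<sigma>0 \<in> graph_auts n H" "\<sigma>0 u = y"
      by (auto simp: F_def)
    obtain \<tau> where \<tau>: "\<tau> \<in> graph_auts n H" "\<tau> u = z"
      using z by (auto simp: orbit_def)
    have perm: "\<sigma>0 permutes {1..n}" "\<tau> permutes {1..n}"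
      using \<sigma>0 \<tau> by (auto simp: graph_auts_def)
    have "inj (\<tau> \<circ> inv \<sigma>0)"
      using perm by (metis inj_compose permutes_inj permutes_inv)
    then have "inj_on (\<lambda>\<sigma>. (\<tau> \<circ> inv \<sigma>0) \<circ> \<sigma>) (F y)"
      by (metis (no_types, lifting) fun.inj_map inj_def inj_onI)
    moreover have "(\<lambda>\<sigma>. (\<tau> \<circ> inv \<sigma>0) \<circ> \<sigma>) ` F y \<subseteq> F z"
    proof
      fix \<rho> assume "\<rho> \<in> (\<lambda>\<sigma>. (\<tau> \<circ> inv \<sigma>0) \<circ> \<sigma>) ` F y"
      then obtain \<sigma> where \<sigma>: "\<sigma> \<in> graph_auts n H" "\<sigma> u = y" "\<rho> = (\<tau> \<circ> inv \<sigma>0) \<circ> \<sigma>"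
        by (auto simp: F_def)
      have "\<rho> \<in> graph_auts n H"
        unfolding \<sigma>(3) by (intro graph_auts_compose graph_auts_inv \<sigma> \<sigma>0 \<tau>)
      moreover have "\<rho> u = z"
        using \<sigma> \<sigma>0(2) \<tau>(2) permutes_inverses(2)[OF perm(1), of u] by simp
      ultimately show "\<rho> \<in> F z"
        by (simp add: F_def)
    qed
    ultimately show ?thesis
      using card_inj_on_le fin by blast
  qed simp
  have "card (orbit n H u) * card (F y) = (\<Sum>z\<in>orbit n H u. card (F y))"
    by simp
  also have "\<dots> \<le> (\<Sum>z\<in>orbit n H u. card (F z))"
    by (intro sum_mono le)
  also have "\<dots> = card (\<Union>z\<in>orbit n H u. F z)"
    by (intro card_UN_disjoint[symmetric]) (auto simp: F_def)
  also have "(\<Union>z\<in>orbit n H u. F z) = graph_auts n H"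
    by (auto simp: F_def orbit_def)
  finally have "real (card (orbit n H u) * card (F y)) \<le> real (card (graph_auts n H))"
    by (rule of_nat_mono)
  then show ?thesis
    using card_orbit_pos[of n H u] by (simp add: F_def pos_le_divide_eq mult.commute)
qed

section \<open>Components and rooted isomorphism\<close>

lemma self_in_component: "u \<in> component H u"
  by (simp add: component_def)

lemma sym_adj: "sym {(x, y). {x, y} \<in> H}"
  by (auto simp: sym_def insert_commute)

lemma component_closed:
  assumes "{x, y} \<in> H"
  shows "x \<in> component H u \<longleftrightarrow> y \<in> component H u"
proof -
  have "{y, x} \<in> H"
    using assms by (simp add: insert_commute)
  then show ?thesis
    using assms unfolding component_def by (auto intro: rtrancl_into_rtrancl)
qed

lemma component_eq:
  assumes "v \<in> component H u"
  shows "component H v = component H u"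
proof -
  have 1: "(u, v) \<in> {(x, y). {x, y} \<in> H}\<^sup>*"
    using assms by (simp add: component_def)
  then have 2: "(v, u) \<in> {(x, y). {x, y} \<in> H}\<^sup>*"
    by (rule symD[OF sym_rtrancl[OF sym_adj]])
  show ?thesis
    using 1 2 unfolding component_def by (auto intro: rtrancl_trans)
qed

lemma component_subset:
  assumes "H \<subseteq> edges n" "u \<in> {1..n}"
  shows "component H u \<subseteq> {1..n}"
proof
  fix v assume "v \<in> component H u"
  then have "(u, v) \<in> {(x, y). {x, y} \<in> H}\<^sup>*"
    by (simp add: component_def)
  then show "v \<in> {1..n}"
  proof (induction rule: rtrancl_induct)
    case (step y z)
    then have "{y, z} \<in> edges n"
      using assms by auto
    then show ?case
      by (auto simp: edges_def doubleton_eq_iff)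
  qed (rule assms)
qed

text \<open>
  The automorphism is \<open>f\<close> on the component of \<open>u\<close> and \<open>f\<^sup>-\<^sup>1\<close> on that of \<open>v\<close>
  if the two differ, so that it swaps the two components.
\<close>

lemma in_orbit_if_isomorphic:
  assumes H: "H \<subseteq> edges n" and u: "u \<in> {1..n}" and v: "v \<in> {1..n}"
    and f: "bij_betw f (component H u) (component H v)" "f u = v"
    and iso: "\<And>x y. x \<in> component H u \<Longrightarrow> y \<in> component H u \<Longrightarrow> {f x, f y} \<in> H \<longleftrightarrow> {x, y} \<in> H"
  shows "v \<in> orbit n H u"
proof -
  define g where "g = inv_into (component H u) f"
  define \<sigma> where "\<sigma> x = (if x \<in> component H u then f x else if x \<in> component H v then g x else x)" for x
  have fin: "f x \<in> component H v" if "x \<in> component H u" for x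
    using f(1) that by (auto simp: bij_betw_def)
  have gin: "g x \<in> component H u" "f (g x) = x" if "x \<in> component H v" for x
    using f(1) that unfolding g_def
    by (auto simp: bij_betw_def inv_into_into f_inv_into_f)
  have gf: "g (f x) = x" if "x \<in> component H u" for x
    using f(1) that unfolding g_def by (simp add: bij_betw_def)
  have eq_or_disj: "component H u = component H v \<or> component H u \<inter> component H v = {}"
    using component_eq by blast
  have inj: "inj \<sigma>"
    using eq_or_disj
  proof
    assume eq: "component H u = component H v"
    have inj_f: "inj_on f (component H u)"
      using f(1) by (simp add: bij_betw_def)
    show ?thesis
    proof (rule injI)
      fix x y assume "\<sigma> x = \<sigma> y"
      then show "x = y"
        using eq fin inj_onD[OF inj_f] by (metis \<sigma>_def)
    qed
  next
    assume disj: "component H u \<inter> component H v = {}"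
    have "\<sigma> (\<sigma> x) = x" for x
      using disj fin gin gf unfolding \<sigma>_def by (auto; blast)
    then show ?thesis
      by (metis injI)
  qed
  have sub: "component H u \<subseteq> {1..n}" "component H v \<subseteq> {1..n}"
    using component_subset H u v by auto
  have "\<sigma> ` {1..n} \<subseteq> {1..n}"
    using sub fin gin(1) unfolding \<sigma>_def by (auto split: if_splits)
  then have "bij_betw \<sigma> {1..n} {1..n}"
    using inj_on_subset[OF inj subset_UNIV, of "{1..n}"] unfolding bij_betw_def
    by (simp add: endo_inj_surj)
  then have perm: "\<sigma> permutes {1..n}"
    by (rule bij_imp_permutes) (use sub in \<open>auto simp: \<sigma>_def\<close>)
  have "{\<sigma> x, \<sigma> y} \<in> H" if xy: "{x, y} \<in> H" for x y
  proof (cases "x \<in> component H u")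
    case True
    then have "y \<in> component H u"
      using component_closed[OF xy] by blast
    then show ?thesis
      using True iso xy by (simp add: \<sigma>_def)
  next
    case False
    then have yu: "y \<notin> component H u"
      using component_closed[OF xy] by blast
    show ?thesis
    proof (cases "x \<in> component H v")
      case True
      then have "y \<in> component H v"
        using component_closed[OF xy] by blast
      then show ?thesis
        using True False yu iso[of "g x" "g y"] gin xy by (simp add: \<sigma>_def)
    next
      case nx: False
      then have "y \<notin> component H v"
        using component_closed[OF xy] by blast
      then show ?thesis
        using nx False yu xy by (simp add: \<sigma>_def)
    qed
  qed
  then have "(`) \<sigma> ` H \<subseteq> H"
    using H by (force simp: edges_def)
  moreover have "inj_on ((`) \<sigma>) H"
    using inj by (simp add: inj_on_def inj_image_eq_iff)
  ultimately have "(`) \<sigma> ` H = H"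
    using H finite_edges by (meson endo_inj_surj finite_subset)
  then have "\<sigma> \<in> graph_auts n H"
    using perm by (simp add: graph_auts_def)
  moreover have "\<sigma> u = v"
    using f(2) self_in_component by (simp add: \<sigma>_def)
  ultimately show ?thesis
    unfolding orbit_def by blast
qed

text \<open>A transposition moves the root to index 0. Fixing the index of the root makes a map
  built from two such enumerations carry root to root.\<close>

lemma ex_rooted_enumeration:
  assumes "finite C" "u \<in> C"
  shows "\<exists>h. bij_betw h {..<card C} C \<and> h 0 = u"
proof -
  obtain h where h: "bij_betw h {0..<card C} C"
    using ex_bij_betw_nat_finite[OF assms(1)] by blast
  then obtain k where k: "k \<in> {0..<card C}" "h k = u"
    using assms(2) by (metis bij_betw_imp_surj_on imageE)
  have "bij_betw (h \<circ> Transposition.transpose 0 k) {0..<card C} C"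
    using k(1) by (intro bij_betw_trans[OF _ h] permutes_imp_bij permutes_swap_id) auto
  moreover have "(h \<circ> Transposition.transpose 0 k) 0 = u"
    using k by simp
  ultimately show ?thesis
    by (metis lessThan_atLeast0)
qed

text \<open>The adjacency relation of the component, read through an arbitrary enumeration that
  starts at the root. It is no canonical form: isomorphic components may get different codes. What
  matters is that equal codes force a rooted isomorphism.\<close>

definition rooted_code :: "nat set set \<Rightarrow> nat \<Rightarrow> nat \<times> (nat \<times> nat) set" where
  "rooted_code H u =
     (let h = (SOME h. bij_betw h {..<card (component H u)} (component H u) \<and> h 0 = u)
      in (card (component H u), {(i, j). i < card (component H u) \<and> j < card (component H u) \<and> {h i, h j} \<in> H}))"

text \<open>The enumeration at \<open>v\<close> after the inverse of the one at \<open>u\<close> is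
  an isomorphism of the components that sends \<open>u\<close> to \<open>v\<close>.\<close>

lemma same_code_in_orbit:
  assumes H: "H \<subseteq> edges n" and u: "u \<in> {1..n}" and v: "v \<in> {1..n}"
    and eq: "rooted_code H u = rooted_code H v"
  shows "v \<in> orbit n H u"
proof -
  define h where "h w = (SOME h. bij_betw h {..<card (component H w)} (component H w) \<and> h 0 = w)" for w
  have h: "bij_betw (h w) {..<card (component H w)} (component H w)" "h w 0 = w" if "w \<in> {1..n}" for w
  proof -
    have "finite (component H w)"
      using component_subset[OF H that] by (rule finite_subset) simp
    from someI_ex[OF ex_rooted_enumeration[OF this self_in_component]]
    show "bij_betw (h w) {..<card (component H w)} (component H w)" "h w 0 = w"
      by (auto simp: h_def)
  qed
  define k where "k = card (component H u)"
  have kv: "card (component H v) = k"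
    and E: "{(i, j). i < k \<and> j < k \<and> {h u i, h u j} \<in> H} = {(i, j). i < k \<and> j < k \<and> {h v i, h v j} \<in> H}"
    using eq by (auto simp: rooted_code_def Let_def h_def[symmetric] k_def)
  have hu: "bij_betw (h u) {..<k} (component H u)" and hv: "bij_betw (h v) {..<k} (component H v)"
    using h(1)[OF u] h(1)[OF v] unfolding kv k_def[symmetric] .
  have "0 < k"
    using hu self_in_component[of u H] unfolding bij_betw_def by (cases k) auto
  define g where "g = inv_into {..<k} (h u)"
  have g: "bij_betw g (component H u) {..<k}"
    unfolding g_def by (rule bij_betw_inv_into[OF hu])
  have gin: "g x < k" "h u (g x) = x" if "x \<in> component H u" for x
    using g hu that unfolding g_def by (auto simp: bij_betw_def f_inv_into_f)
  show ?thesis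
  proof (rule in_orbit_if_isomorphic[OF H u v])
    show "bij_betw (h v \<circ> g) (component H u) (component H v)"
      using g hv by (rule bij_betw_trans)
    have "g u = 0"
      using h(2)[OF u] hu \<open>0 < k\<close> unfolding g_def
      by (metis bij_betw_def inv_into_f_f lessThan_iff)
    then show "(h v \<circ> g) u = v"
      using h(2)[OF v] by simp
  next
    fix x y assume xy: "x \<in> component H u" "y \<in> component H u"
    have "(g x, g y) \<in> {(i, j). i < k \<and> j < k \<and> {h u i, h u j} \<in> H} \<longleftrightarrow>
          (g x, g y) \<in> {(i, j). i < k \<and> j < k \<and> {h v i, h v j} \<in> H}"
      using E by simp
    then show "{(h v \<circ> g) x, (h v \<circ> g) y} \<in> H \<longleftrightarrow> {x, y} \<in> H"
      using gin xy by simp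
  qed
qed

text \<open>A finite set, independent of \<open>n\<close>, that holds the codes of all components
  with at most \<open>K\<close> vertices.\<close>

definition codes :: "nat \<Rightarrow> (nat \<times> (nat \<times> nat) set) set" where
  "codes K = {..K} \<times> Pow ({..<K} \<times> {..<K})"

text \<open>The sum of the reciprocal orbit sizes is the number of orbits.\<close>

lemma number_of_orbits_le:
  assumes H: "H \<subseteq> edges n"
  shows "(\<Sum>u\<in>{1..n}. 1 / real (card (orbit n H u)))
       \<le> real (card (codes K)) + real (card {u\<in>{1..n}. card (component H u) > K})"
proof -
  define S where "S = {u\<in>{1..n}. card (component H u) \<le> K}"
  define L where "L = {u\<in>{1..n}. card (component H u) > K}"
  define T where "T = rooted_code H ` S"
  have fin: "finite S" "finite L" "finite T"
    by (auto simp: S_def L_def T_def)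
  have le1: "1 / real (card (orbit n H u)) \<le> 1" for u
    using card_orbit_pos[of n H u] by (simp add: divide_le_eq)
  \<comment> \<open>Vertices sharing a code lie in one orbit, which is therefore at least as large
    as their class: each class contributes at most 1.\<close>
  have fib: "(\<Sum>u | u \<in> S \<and> rooted_code H u = c. 1 / real (card (orbit n H u))) \<le> 1" if "c \<in> T" for c
  proof -
    define X where "X = {u \<in> S. rooted_code H u = c}"
    have "finite X" "X \<noteq> {}"
      using that fin by (auto simp: X_def T_def)
    then have pos: "card X > 0"
      by (simp add: card_gt_0_iff)
    have "(\<Sum>u\<in>X. 1 / real (card (orbit n H u))) \<le> (\<Sum>u\<in>X. 1 / real (card X))"
    proof (rule sum_mono)
      fix u assume "u \<in> X"
      then have "X \<subseteq> orbit n H u"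
        using same_code_in_orbit[OF H] by (auto simp: X_def S_def)
      then have "card X \<le> card (orbit n H u)"
        by (intro card_mono) auto
      then show "1 / real (card (orbit n H u)) \<le> 1 / real (card X)"
        using pos by (simp add: frac_le)
    qed
    also have "\<dots> = 1"
      using pos by simp
    finally show ?thesis
      by (simp add: X_def)
  qed
  have "T \<subseteq> codes K"
    by (auto simp: T_def S_def codes_def rooted_code_def Let_def)
  then have cT: "card T \<le> card (codes K)"
    by (intro card_mono) (auto simp: codes_def)
  have "(\<Sum>u\<in>S. 1 / real (card (orbit n H u))) =
        (\<Sum>c\<in>T. \<Sum>u | u \<in> S \<and> rooted_code H u = c. 1 / real (card (orbit n H u)))"
    unfolding T_def using fin(1) by (rule sum.image_gen)
  also have "\<dots> \<le> (\<Sum>c\<in>T. 1)"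
    by (intro sum_mono fib)
  also have "\<dots> \<le> real (card (codes K))"
    using cT by simp
  finally have S: "(\<Sum>u\<in>S. 1 / real (card (orbit n H u))) \<le> real (card (codes K))" .
  \<comment> \<open>Vertices of large components are charged the trivial bound 1 each.\<close>
  have "(\<Sum>u\<in>L. 1 / real (card (orbit n H u))) \<le> (\<Sum>u\<in>L. 1)"
    by (intro sum_mono le1)
  then have L: "(\<Sum>u\<in>L. 1 / real (card (orbit n H u))) \<le> real (card L)"
    by simp
  have "{1..n} = S \<union> L" "S \<inter> L = {}"
    by (auto simp: S_def L_def)
  then have "(\<Sum>u\<in>{1..n}. 1 / real (card (orbit n H u))) =
      (\<Sum>u\<in>S. 1 / real (card (orbit n H u))) + (\<Sum>u\<in>L. 1 / real (card (orbit n H u)))"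
    using fin by (simp add: sum.union_disjoint)
  then show ?thesis
    using S L by (simp add: L_def)
qed

section \<open>Components of subcritical random graphs\<close>

fun path_edges :: "nat list \<Rightarrow> nat set set" where
  "path_edges (x # y # xs) = insert {x, y} (path_edges (y # xs))"
| "path_edges _ = {}"

definition paths :: "nat \<Rightarrow> nat set set \<Rightarrow> nat list set" where
  "paths n H = {xs. xs \<noteq> [] \<and> distinct xs \<and> set xs \<subseteq> {1..n} \<and> path_edges xs \<subseteq> H}"

lemma path_edges_subset: "e \<in> path_edges xs \<Longrightarrow> e \<subseteq> set xs"
  by (induction xs rule: path_edges.induct) auto

lemma finite_path_edges [simp]: "finite (path_edges xs)"
  by (induction xs rule: path_edges.induct) auto

lemma card_path_edges: "distinct xs \<Longrightarrow> card (path_edges xs) = length xs - 1"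
proof (induction xs rule: path_edges.induct)
  case (1 x y xs)
  then have "{x, y} \<notin> path_edges (y # xs)"
    using path_edges_subset[of "{x, y}" "y # xs"] by auto
  then show ?case
    using 1 by simp
qed auto

lemma path_edges_append: "path_edges ys \<subseteq> path_edges (xs @ ys)"
proof (induction xs)
  case (Cons x xs)
  show ?case
    using Cons.IH by (cases "xs @ ys") auto
qed simp

text \<open>A new first vertex \<open>y\<close> is put in front of a self-avoiding path; if
  \<open>y\<close> already occurs there, the suffix starting at \<open>y\<close> is taken
  instead.\<close>

lemma ex_path:
  assumes H: "H \<subseteq> edges n" and v: "v \<in> {1..n}" and "v \<in> component H u"
  shows "\<exists>xs\<in>paths n H. hd xs = u \<and> last xs = v"
proof -
  have "(u, v) \<in> {(x, y). {x, y} \<in> H}\<^sup>*"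
    using assms(3) by (simp add: component_def)
  then show ?thesis
  proof (induction rule: converse_rtrancl_induct)
    case base
    have "[v] \<in> paths n H"
      using v by (simp add: paths_def)
    then show ?case
      by force
  next
    case (step y z)
    then obtain xs where xs: "xs \<in> paths n H" "hd xs = z" "last xs = v"
      by blast
    have yz: "{y, z} \<in> H"
      using step by simp
    then have "{y, z} \<in> edges n"
      using H by blast
    then have y: "y \<in> {1..n}"
      by (auto simp: edges_def doubleton_eq_iff)
    show ?case
    proof (cases "y \<in> set xs")
      case True
      then obtain as bs where s: "xs = as @ y # bs"
        by (meson split_list)
      have "y # bs \<in> paths n H"
        using xs(1) path_edges_append[of "y # bs" as] unfolding s paths_def by auto
      then show ?thesis
        using xs(3) s by (intro bexI[of _ "y # bs"]) auto
    next
      case False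
      have "xs = z # tl xs"
        using xs by (cases xs) (auto simp: paths_def)
      then have "path_edges (y # xs) = insert {y, z} (path_edges xs)"
        by (metis path_edges.simps(1))
      then have "y # xs \<in> paths n H"
        using xs(1) False y yz by (auto simp: paths_def)
      then show ?thesis
        using xs by (intro bexI[of _ "y # xs"]) (auto simp: paths_def)
    qed
  qed
qed

lemma finite_paths [simp]: "finite (paths n H)"
proof -
  have "paths n H \<subseteq> {xs. set xs \<subseteq> {1..n} \<and> distinct xs}"
    by (auto simp: paths_def)
  then show ?thesis
    by (rule finite_subset) (simp add: finite_subset_distinct)
qed

text \<open>Double counting of pairs of vertices in a common component: a vertex of a large
  component starts more than \<open>K\<close> of them, and each pair is the pair of endpoints of
  some self-avoiding path.\<close>

lemma card_large_components_le:
  assumes H: "H \<subseteq> edges n"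
  shows "K * card {u \<in> {1..n}. card (component H u) > K} \<le> card (paths n H)"
proof -
  have fin: "finite (component H u)" if "u \<in> {1..n}" for u
    using component_subset[OF H that] by (rule finite_subset) simp
  have "K * card {u \<in> {1..n}. card (component H u) > K} =
        (\<Sum>u\<in>{u \<in> {1..n}. card (component H u) > K}. K)"
    by simp
  also have "\<dots> \<le> (\<Sum>u\<in>{u \<in> {1..n}. card (component H u) > K}. card (component H u))"
    by (intro sum_mono) auto
  also have "\<dots> \<le> (\<Sum>u\<in>{1..n}. card (component H u))"
    by (intro sum_mono2) auto
  also have "\<dots> = card (SIGMA u:{1..n}. component H u)"
    using fin by (subst card_SigmaI) auto
  also have "(SIGMA u:{1..n}. component H u) \<subseteq> (\<lambda>xs. (hd xs, last xs)) ` paths n H"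
  proof
    fix x assume "x \<in> (SIGMA u:{1..n}. component H u)"
    then obtain u v where x: "x = (u, v)" "u \<in> {1..n}" "v \<in> component H u"
      by blast
    then obtain xs where "xs \<in> paths n H" "hd xs = u" "last xs = v"
      using ex_path[OF H _ x(3)] component_subset[OF H x(2)] by blast
    then show "x \<in> (\<lambda>xs. (hd xs, last xs)) ` paths n H"
      using x by force
  qed
  then have "card (SIGMA u:{1..n}. component H u) \<le> card ((\<lambda>xs. (hd xs, last xs)) ` paths n H)"
    by (intro card_mono) auto
  also have "\<dots> \<le> card (paths n H)"
    by (rule card_image_le) simp
  finally show ?thesis
    by simp
qed

section \<open>Expectations over an Erdos--Renyi graph\<close>

lemma sum_Pow_binomial:
  fixes a b :: real
  assumes "finite A"
  shows "(\<Sum>X\<in>Pow A. a ^ card X * b ^ card (A - X)) = (a + b) ^ card A"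
  using prod_add[OF assms, of "\<lambda>_. a" "\<lambda>_. b"] by simp

text \<open>Removing \<open>F\<close> turns the supersets of \<open>F\<close> within
  \<open>E\<close> into the subsets of \<open>E - F\<close>.\<close>

lemma sum_supersets_binomial:
  fixes a b :: real
  assumes "finite E" "F \<subseteq> E"
  shows "(\<Sum>H | H \<subseteq> E \<and> F \<subseteq> H. a ^ card (H - F) * b ^ card (E - H)) = (a + b) ^ card (E - F)"
proof -
  have "(\<Sum>X\<in>Pow (E - F). a ^ card X * b ^ card (E - F - X)) =
        (\<Sum>H | H \<subseteq> E \<and> F \<subseteq> H. a ^ card (H - F) * b ^ card (E - H))"
    by (rule sum.reindex_bij_witness[of _ "\<lambda>H. H - F" "\<lambda>X. X \<union> F"])
       (use assms in \<open>auto simp: Diff_triv Un_Diff intro!: arg_cong2[of _ _ _ _ "(*)"]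
          arg_cong[of _ _ "\<lambda>X. _ ^ card X"]\<close>)
  then show ?thesis
    using sum_Pow_binomial[of "E - F" a b] assms by simp
qed

text \<open>For \<open>a\<close> in the unit interval this is the probability that all edges of
  \<open>F\<close> are present when edges are kept independently with probability
  \<open>a\<close>.\<close>

lemma prob_supergraph:
  fixes a :: real
  assumes "finite E" "F \<subseteq> E"
  shows "(\<Sum>H | H \<subseteq> E \<and> F \<subseteq> H. a ^ card H * (1 - a) ^ card (E - H)) = a ^ card F"
proof -
  have "a ^ card H = a ^ card F * a ^ card (H - F)" if "H \<subseteq> E" "F \<subseteq> H" for H
  proof -
    have "card H = card F + card (H - F)"
      using that assms by (metis card_Diff_subset card_mono finite_subset le_add_diff_inverse)
    then show ?thesis
      by (simp add: power_add)
  qed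
  then have "(\<Sum>H | H \<subseteq> E \<and> F \<subseteq> H. a ^ card H * (1 - a) ^ card (E - H)) =
     (\<Sum>H | H \<subseteq> E \<and> F \<subseteq> H. a ^ card F * (a ^ card (H - F) * (1 - a) ^ card (E - H)))"
    by (intro sum.cong) auto
  also have "\<dots> = a ^ card F * (a + (1 - a)) ^ card (E - F)"
    unfolding sum_distrib_left[symmetric] sum_supersets_binomial[OF assms] ..
  finally show ?thesis
    by simp
qed

text \<open>At most \<open>n ^ (k + 1)\<close> vertex lists have \<open>k\<close> steps, which
  leaves a geometric series of ratio \<open>n * a\<close>.\<close>

lemma sum_paths_le:
  fixes a :: real
  assumes "0 \<le> a" "real n * a < 1"
  shows "(\<Sum>xs\<in>paths n H. a ^ (length xs - 1)) \<le> real n / (1 - real n * a)"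
proof -
  define P where "P k = {xs. set xs \<subseteq> {1..n} \<and> length xs = Suc k}" for k
  have finP: "finite (P k)" for k
    unfolding P_def by (rule finite_lists_length_eq) simp
  \<comment> \<open>Distinctness is used only to bound the length by \<open>n\<close>; it is then
    given up.\<close>
  have sub: "paths n H \<subseteq> (\<Union>k\<in>{..<n}. P k)"
  proof
    fix xs assume xs: "xs \<in> paths n H"
    then have "length xs = card (set xs)" "card (set xs) \<le> card {1..n}"
      unfolding paths_def by (simp add: distinct_card, intro card_mono) auto
    then have "length xs - 1 < n" "xs \<in> P (length xs - 1)"
      using xs by (auto simp: paths_def P_def Suc_diff_1 neq_Nil_conv)
    then show "xs \<in> (\<Union>k\<in>{..<n}. P k)"
      by blast
  qed
  have "(\<Sum>xs\<in>paths n H. a ^ (length xs - 1)) \<le> (\<Sum>xs\<in>(\<Union>k\<in>{..<n}. P k). a ^ (length xs - 1))"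
    using sub finP assms by (intro sum_mono2) auto
  also have "\<dots> = (\<Sum>k<n. \<Sum>xs\<in>P k. a ^ (length xs - 1))"
    by (intro sum.UNION_disjoint) (use finP in \<open>auto simp: P_def\<close>)
  also have "\<dots> = (\<Sum>k<n. real n * (real n * a) ^ k)"
  proof (intro sum.cong refl)
    fix k
    have "(\<Sum>xs\<in>P k. a ^ (length xs - 1)) = (\<Sum>xs\<in>P k. a ^ k)"
      by (intro sum.cong) (auto simp: P_def)
    also have "\<dots> = real (n ^ Suc k) * a ^ k"
      unfolding P_def by (simp add: card_lists_length_eq del: power_Suc)
    finally show "(\<Sum>xs\<in>P k. a ^ (length xs - 1)) = real n * (real n * a) ^ k"
      by (simp add: power_mult_distrib)
  qed
  also have "\<dots> = real n * ((1 - (real n * a) ^ n) / (1 - real n * a))"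
    using assms(2) unfolding sum_distrib_left[symmetric] sum_gp_strict by simp
  also have "\<dots> \<le> real n * (1 / (1 - real n * a))"
    using assms by (intro mult_left_mono divide_right_mono) auto
  finally show ?thesis
    by simp
qed

text \<open>First-moment method: the number of large components' vertices is bounded by the number
  of paths over \<open>K\<close>, and after exchanging sums a path with \<open>k\<close> edges
  survives with probability \<open>a ^ k\<close>.\<close>

lemma expected_large_components_le:
  fixes a :: real
  assumes a: "0 \<le> a" "a \<le> 1" "real n * a < 1" and K: "K > 0"
  shows "(\<Sum>H\<in>Pow (edges n). a ^ card H * (1 - a) ^ card (edges n - H)
            * real (card {u \<in> {1..n}. card (component H u) > K}))
         \<le> real n / (real K * (1 - real n * a))"
proof -
  let ?w = "\<lambda>H. a ^ card H * (1 - a) ^ card (edges n - H)"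
  let ?P = "paths n (edges n)"
  have w: "0 \<le> ?w H" for H
    using a by simp
  have "(\<Sum>H\<in>Pow (edges n). ?w H * real (card {u \<in> {1..n}. card (component H u) > K}))
      \<le> (\<Sum>H\<in>Pow (edges n). ?w H * (real (card (paths n H)) / real K))"
  proof (intro sum_mono mult_left_mono w)
    fix H assume "H \<in> Pow (edges n)"
    then have "K * card {u \<in> {1..n}. card (component H u) > K} \<le> card (paths n H)"
      using card_large_components_le by blast
    then have "real K * real (card {u \<in> {1..n}. card (component H u) > K}) \<le> real (card (paths n H))"
      by (metis of_nat_mono of_nat_mult)
    then show "real (card {u \<in> {1..n}. card (component H u) > K}) \<le> real (card (paths n H)) / real K"
      using K by (simp add: pos_le_divide_eq mult.commute)
  qed
  also have "\<dots> = (\<Sum>H\<in>Pow (edges n). ?w H * real (card (paths n H))) / real K"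
    by (simp add: sum_divide_distrib)
  also have "(\<Sum>H\<in>Pow (edges n). ?w H * real (card (paths n H))) =
      (\<Sum>H\<in>Pow (edges n). \<Sum>xs\<in>?P. if path_edges xs \<subseteq> H then ?w H else 0)"
  proof (intro sum.cong refl)
    fix H assume "H \<in> Pow (edges n)"
    then have "paths n H = {xs \<in> ?P. path_edges xs \<subseteq> H}"
      by (auto simp: paths_def)
    then show "?w H * real (card (paths n H)) = (\<Sum>xs\<in>?P. if path_edges xs \<subseteq> H then ?w H else 0)"
      by (simp add: sum.inter_filter[symmetric])
  qed
  also have "\<dots> = (\<Sum>xs\<in>?P. \<Sum>H\<in>Pow (edges n). if path_edges xs \<subseteq> H then ?w H else 0)"
    by (rule sum.swap)
  also have "\<dots> = (\<Sum>xs\<in>?P. a ^ (length xs - 1))"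
  proof (intro sum.cong refl)
    fix xs assume xs: "xs \<in> ?P"
    have "(\<Sum>H\<in>Pow (edges n). if path_edges xs \<subseteq> H then ?w H else 0) =
          (\<Sum>H | H \<subseteq> edges n \<and> path_edges xs \<subseteq> H. ?w H)"
      by (simp add: sum.inter_filter[symmetric] Pow_def)
    also have "\<dots> = a ^ card (path_edges xs)"
      by (rule prob_supergraph) (use xs in \<open>auto simp: paths_def\<close>)
    also have "\<dots> = a ^ (length xs - 1)"
      using xs by (simp add: card_path_edges paths_def)
    finally show "(\<Sum>H\<in>Pow (edges n). if path_edges xs \<subseteq> H then ?w H else 0) = a ^ (length xs - 1)" .
  qed
  also have "\<dots> / real K \<le> (real n / (1 - real n * a)) / real K"
    by (intro divide_right_mono sum_paths_le a) simp
  finally show ?thesis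
    by (simp add: mult.commute)
qed

text \<open>For fixed \<open>K\<close> the first term is constant in \<open>n\<close>, while the
  second is a fraction of \<open>n\<close> that shrinks as \<open>K\<close> grows.\<close>

lemma expected_number_of_orbits_le:
  fixes a :: real
  assumes a: "0 \<le> a" "a \<le> 1" "real n * a < 1" and K: "K > 0"
  shows "(\<Sum>H\<in>Pow (edges n). a ^ card H * (1 - a) ^ card (edges n - H)
            * (\<Sum>u\<in>{1..n}. 1 / real (card (orbit n H u))))
         \<le> real (card (codes K)) + real n / (real K * (1 - real n * a))"
proof -
  let ?w = "\<lambda>H. a ^ card H * (1 - a) ^ card (edges n - H)"
  have "(\<Sum>H\<in>Pow (edges n). ?w H * (\<Sum>u\<in>{1..n}. 1 / real (card (orbit n H u)))) \<le>
    (\<Sum>H\<in>Pow (edges n). ?w H * (real (card (codes K)) +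
        real (card {u \<in> {1..n}. card (component H u) > K})))"
    using a by (intro sum_mono mult_left_mono number_of_orbits_le) auto
  also have "\<dots> = (\<Sum>H\<in>Pow (edges n). ?w H) * real (card (codes K)) +
     (\<Sum>H\<in>Pow (edges n). ?w H * real (card {u \<in> {1..n}. card (component H u) > K}))"
    by (simp add: distrib_left sum.distrib sum_distrib_right)
  also have "(\<Sum>H\<in>Pow (edges n). ?w H) = 1"
    using sum_Pow_binomial[of "edges n" a "1 - a"] by simp
  finally show ?thesis
    using expected_large_components_le[OF assms] by simp
qed

section \<open>The law of the graphs\<close>

text \<open>The joint law of the indicators \<open>(G\<^sup>1\<^sub>e, \<dots>, G\<^sup>p\<^sub>e)\<close> at a single edge.\<close>

definition edge_law :: "nat \<Rightarrow> real \<Rightarrow> real \<Rightarrow> (nat \<Rightarrow> bool) pmf" where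
  "edge_law p q s = bind_pmf (bernoulli_pmf q)
     (\<lambda>b. Pi_pmf {1..p} False (\<lambda>_. if b then bernoulli_pmf s else return_pmf False))"

lemma pmf_Pi_Pi:
  assumes "finite A" "finite B"
  shows "pmf (Pi_pmf A (\<lambda>_. d) (\<lambda>i. Pi_pmf B d (k i))) G =
    (if \<forall>i e. G i e \<noteq> d \<longrightarrow> i \<in> A \<and> e \<in> B then \<Prod>i\<in>A. \<Prod>e\<in>B. pmf (k i e) (G i e) else 0)"
proof (cases "\<forall>i e. G i e \<noteq> d \<longrightarrow> i \<in> A \<and> e \<in> B")
  case True
  have "pmf (Pi_pmf A (\<lambda>_. d) (\<lambda>i. Pi_pmf B d (k i))) G = (\<Prod>i\<in>A. pmf (Pi_pmf B d (k i)) (G i))"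
    by (rule pmf_Pi') (use True assms in auto)
  also have "\<dots> = (\<Prod>i\<in>A. \<Prod>e\<in>B. pmf (k i e) (G i e))"
    by (intro prod.cong refl pmf_Pi') (use True assms in auto)
  finally show ?thesis
    unfolding if_P[OF True] .
next
  case False
  then obtain i e where ie: "G i e \<noteq> d" "i \<notin> A \<or> e \<notin> B"
    by blast
  show ?thesis
  proof (cases "i \<in> A")
    case True
    then have "pmf (Pi_pmf B d (k i)) (G i) = 0"
      using ie assms by (intro pmf_Pi_outside) auto
    then have "(\<Prod>i\<in>A. pmf (Pi_pmf B d (k i)) (G i)) = 0"
      using True assms(1) by (intro prod_zero) auto
    then show ?thesis
      unfolding if_not_P[OF False] using assms(1) by (simp only: pmf_Pi split: if_split) blast
  next
    case nA: False
    then have "G i \<noteq> (\<lambda>_. d)"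
      using ie(1) by auto
    then show ?thesis
      unfolding if_not_P[OF False] by (intro pmf_Pi_outside) (use nA assms(1) in auto)
  qed
qed

text \<open>Both nestings give a family the same double product as its mass. Given the master graph,
  one may thus sample edge by edge instead of graph by graph.\<close>

lemma Pi_pmf_swap:
  assumes "finite A" "finite B"
  shows "Pi_pmf A (\<lambda>_. d) (\<lambda>i. Pi_pmf B d (k i)) =
    map_pmf (\<lambda>X i e. X e i) (Pi_pmf B (\<lambda>_. d) (\<lambda>e. Pi_pmf A d (\<lambda>i. k i e)))"
proof (rule pmf_eqI)
  fix G
  have inj: "inj (\<lambda>X i e. X e i)"
    by (auto simp: inj_def fun_eq_iff)
  have "pmf (map_pmf (\<lambda>X i e. X e i) (Pi_pmf B (\<lambda>_. d) (\<lambda>e. Pi_pmf A d (\<lambda>i. k i e)))) G =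
        pmf (Pi_pmf B (\<lambda>_. d) (\<lambda>e. Pi_pmf A d (\<lambda>i. k i e))) (\<lambda>e i. G i e)"
    using pmf_map_inj'[OF inj, of _ "\<lambda>e i. G i e"] by simp
  also have "\<dots> = pmf (Pi_pmf A (\<lambda>_. d) (\<lambda>i. Pi_pmf B d (k i))) G"
  proof -
    have "(\<Prod>e\<in>B. \<Prod>i\<in>A. pmf (k i e) (G i e)) = (\<Prod>i\<in>A. \<Prod>e\<in>B. pmf (k i e) (G i e))"
      by (rule prod.swap)
    then show ?thesis
      unfolding pmf_Pi_Pi[OF assms] pmf_Pi_Pi[OF assms(2,1)] by auto
  qed
  finally show "pmf (Pi_pmf A (\<lambda>_. d) (\<lambda>i. Pi_pmf B d (k i))) G =
      pmf (map_pmf (\<lambda>X i e. X e i) (Pi_pmf B (\<lambda>_. d) (\<lambda>e. Pi_pmf A d (\<lambda>i. k i e)))) G" ..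
qed

text \<open>Independence across edges: once the product over edges is outermost, the draw of the
  master graph is absorbed into each edge separately.\<close>

lemma correlated_ER_eq_map:
  "correlated_ER p n lam s =
     map_pmf (\<lambda>X i e. X e i) (Pi_pmf (edges n) (\<lambda>_. False) (\<lambda>_. edge_law p (lam / real n) s))"
  unfolding correlated_ER_def master_graph_def random_subgraph_def edge_law_def
  unfolding Pi_pmf_bind[OF finite_edges, where d' = False] map_bind_pmf
  by (intro bind_pmf_cong refl Pi_pmf_swap) simp_all

lemma pmf_correlated_ER:
  assumes "G \<in> observations p n"
  shows "pmf (correlated_ER p n lam s) G = (\<Prod>e\<in>edges n. pmf (edge_law p (lam / real n) s) (\<lambda>i. G i e))"
proof -
  have inj: "inj (\<lambda>X i e. X e i)"
    by (auto simp: inj_def fun_eq_iff)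
  have "pmf (correlated_ER p n lam s) G =
      pmf (Pi_pmf (edges n) (\<lambda>_. False) (\<lambda>_. edge_law p (lam / real n) s)) (\<lambda>e i. G i e)"
    unfolding correlated_ER_eq_map using pmf_map_inj'[OF inj, of _ "\<lambda>e i. G i e"] by simp
  also have "\<dots> = (\<Prod>e\<in>edges n. pmf (edge_law p (lam / real n) s) (\<lambda>i. G i e))"
    using assms by (intro pmf_Pi') (auto simp: observations_def)
  finally show ?thesis .
qed

lemma set_pmf_correlated_ER: "set_pmf (correlated_ER p n lam s) \<subseteq> observations p n"
proof
  fix G assume "G \<in> set_pmf (correlated_ER p n lam s)"
  then obtain g where "pmf (Pi_pmf {1..p} (\<lambda>_. False) (\<lambda>_. random_subgraph n s g)) G \<noteq> 0"
    by (auto simp: correlated_ER_def set_pmf_iff)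
  then show "G \<in> observations p n"
    unfolding random_subgraph_def
    by (auto simp: pmf_Pi_Pi observations_def split: if_splits)
qed

lemma finite_observations [simp]: "finite (observations p n)"
proof -
  have "inj_on (\<lambda>G. {(i, e). G i e}) (observations p n)"
    by (auto simp: inj_on_def fun_eq_iff set_eq_iff)
  moreover have "(\<lambda>G. {(i, e). G i e}) ` observations p n \<subseteq> Pow ({1..p} \<times> edges n)"
    by (auto simp: observations_def)
  ultimately show ?thesis
    by (meson finite_Pow_iff finite_SigmaI finite_atLeastAtMost finite_edges finite_subset inj_on_finite)
qed

lemma finite_alignments [simp]: "finite (alignments p n)"
proof -
  have "alignments p n \<subseteq> PiE_dflt {2..p} id (\<lambda>_. {\<sigma>. \<sigma> permutes {1..n}})"
  proof
    fix \<pi> assume \<pi>: "\<pi> \<in> alignments p n"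
    have "\<pi> i = id" if "i \<notin> {2..p}" for i
      using that \<pi> by (cases "i = 1") (auto simp: alignments_def)
    then show "\<pi> \<in> PiE_dflt {2..p} id (\<lambda>_. {\<sigma>. \<sigma> permutes {1..n}})"
      using \<pi> by (auto simp: alignments_def PiE_dflt_def)
  qed
  then show ?thesis
    by (rule finite_subset) (auto intro!: finite_PiE_dflt simp: finite_permutations)
qed

text \<open>The value does not depend on \<pi>, so replacing \<open>\<pi> 2\<close> by
  \<open>\<pi> 2 \<circ> \<sigma>\<close> preserves the mass.\<close>

lemma pmf_random_alignment:
  assumes "\<pi> \<in> alignments p n"
  shows "pmf (random_alignment p n) \<pi> = (1 / fact n) ^ (p - 1)"
proof -
  have out: "\<pi> i = id" if "i \<notin> {2..p}" for i
    using that assms by (cases "i = 1") (auto simp: alignments_def)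
  have ne: "{\<sigma>. \<sigma> permutes {1..n}} \<noteq> {}"
    using permutes_id by blast
  have "pmf (random_alignment p n) \<pi> = (\<Prod>i\<in>{2..p}. pmf (pmf_of_set {\<sigma>. \<sigma> permutes {1..n}}) (\<pi> i))"
    unfolding random_alignment_def by (rule pmf_Pi') (auto simp: out)
  also have "\<dots> = (\<Prod>i\<in>{2..p}. 1 / fact n)"
    using assms ne
    by (intro prod.cong) (auto simp: alignments_def finite_permutations card_permutations indicator_def)
  finally show ?thesis
    by simp
qed

lemma set_pmf_random_alignment: "set_pmf (random_alignment p n) \<subseteq> alignments p n"
proof
  have ne: "{\<sigma>. \<sigma> permutes {1..n}} \<noteq> {}"
    using permutes_id by blast
  fix \<pi> assume "\<pi> \<in> set_pmf (random_alignment p n)"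
  then show "\<pi> \<in> alignments p n"
    using ne by (auto simp: random_alignment_def set_Pi_pmf PiE_dflt_def alignments_def
        finite_permutations)
qed

section \<open>Probabilities at a single edge\<close>

lemma pmf_edge_law:
  assumes "0 \<le> q" "q \<le> 1" "\<And>i. x i \<Longrightarrow> i \<in> {1..p}"
  shows "pmf (edge_law p q s) x = q * (\<Prod>i\<in>{1..p}. pmf (bernoulli_pmf s) (x i))
     + (1 - q) * (\<Prod>i\<in>{1..p}. if x i then 0 else 1)"
proof -
  have "pmf (Pi_pmf {1..p} False (\<lambda>_. k)) x = (\<Prod>i\<in>{1..p}. pmf k (x i))" for k
    using assms(3) by (intro pmf_Pi') auto
  moreover have "(\<Prod>i\<in>{1..p}. pmf (return_pmf False) (x i)) = (\<Prod>i\<in>{1..p}. if x i then 0 else 1)"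
    by (intro prod.cong) auto
  ultimately show ?thesis
    using assms(1,2) by (simp add: edge_law_def pmf_bind)
qed

lemma pmf_edge_law_none:
  assumes "0 \<le> q" "q \<le> 1" "0 \<le> s" "s \<le> 1"
  shows "pmf (edge_law p q s) (\<lambda>_. False) = q * (1 - s) ^ p + (1 - q)"
  using assms by (subst pmf_edge_law) auto

lemma pmf_edge_law_single:
  assumes "0 \<le> q" "q \<le> 1" "0 \<le> s" "s \<le> 1" "p \<ge> 2"
  shows "pmf (edge_law p q s) (\<lambda>i. i = 2) = q * s * (1 - s) ^ (p - 1)"
proof -
  have 2: "2 \<in> {1..p}"
    using assms by simp
  have "(\<Prod>i\<in>{1..p}. pmf (bernoulli_pmf s) (i = 2)) =
        s * (\<Prod>i\<in>{1..p} - {2}. pmf (bernoulli_pmf s) (i = 2))"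
    using assms 2 by (subst prod.remove[of _ 2]) auto
  also have "(\<Prod>i\<in>{1..p} - {2}. pmf (bernoulli_pmf s) (i = 2)) = (\<Prod>i\<in>{1..p} - {2}. 1 - s)"
    using assms by (intro prod.cong) auto
  also have "\<dots> = (1 - s) ^ (p - 1)"
    using 2 by simp
  finally have "(\<Prod>i\<in>{1..p}. pmf (bernoulli_pmf s) (i = 2)) = s * (1 - s) ^ (p - 1)" .
  moreover have "(\<Prod>i\<in>{1..p}. if i = 2 then 0 else 1 :: real) = 0"
    using 2 by (intro prod_zero) auto
  ultimately show ?thesis
    using assms 2 by (subst pmf_edge_law) auto
qed

lemma prob_edge_law_second:
  assumes "0 \<le> q" "q \<le> 1" "0 \<le> s" "s \<le> 1" "p \<ge> 2"
  shows "measure_pmf.prob (edge_law p q s) {x. x 2} = q * s"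
proof -
  have "map_pmf (\<lambda>x. x 2) (edge_law p q s) =
      bind_pmf (bernoulli_pmf q) (\<lambda>b. if b then bernoulli_pmf s else return_pmf False)"
    using assms(5) by (simp add: edge_law_def map_bind_pmf Pi_pmf_component)
  then have "pmf (map_pmf (\<lambda>x. x 2) (edge_law p q s)) True = q * s"
    using assms by (simp add: pmf_bind)
  then show ?thesis
    by (simp add: pmf_map vimage_def)
qed

lemma prob_edge_law_not_second:
  assumes "0 \<le> q" "q \<le> 1" "0 \<le> s" "s \<le> 1" "p \<ge> 2"
  shows "measure_pmf.prob (edge_law p q s) {x. \<not> x 2} = 1 - q * s"
proof -
  have "{x. \<not> x 2} = UNIV - {x :: nat \<Rightarrow> bool. x 2}"
    by auto
  then show ?thesis
    using measure_pmf.prob_compl[of "{x. x 2}" "edge_law p q s"] prob_edge_law_second[OF assms] by simp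
qed

text \<open>Among the configurations with the edge in the second graph, only
  \<open>\<lambda>i. i = 2\<close> has it in no other. For \<open>q = lam / n\<close>, multiplying
  by \<open>n\<close> yields the quantity assumed to be below 1.\<close>

lemma prob_edge_law_shared:
  assumes "0 \<le> q" "q \<le> 1" "0 \<le> s" "s \<le> 1" "p \<ge> 2"
  shows "measure_pmf.prob (edge_law p q s) {x. x 2 \<and> (\<exists>i. i \<noteq> 2 \<and> x i)} =
    q * s * (1 - (1 - s) ^ (p - 1))"
proof -
  have "{x :: nat \<Rightarrow> bool. x 2 \<and> (\<exists>i. i \<noteq> 2 \<and> x i)} = {x. x 2} - {\<lambda>i. i = 2}"
    by (auto simp: fun_eq_iff)
  then have "measure_pmf.prob (edge_law p q s) {x. x 2 \<and> (\<exists>i. i \<noteq> 2 \<and> x i)} =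
      q * s - pmf (edge_law p q s) (\<lambda>i. i = 2)"
    using prob_edge_law_second[OF assms]
    by (simp add: measure_pmf.finite_measure_Diff measure_pmf_single)
  then show ?thesis
    using pmf_edge_law_single[OF assms] by (simp add: algebra_simps)
qed

section \<open>Factoring the likelihood through the shared graph\<close>

definition second :: "(nat \<Rightarrow> nat set \<Rightarrow> bool) \<Rightarrow> nat set set" where
  "second G = {e. G 2 e}"

definition others :: "(nat \<Rightarrow> nat set \<Rightarrow> bool) \<Rightarrow> nat set set" where
  "others G = {e. \<exists>i. i \<noteq> 2 \<and> G i e}"

text \<open>The likelihood ratio at one edge between presence in the second graph alone and absence
  from all graphs.\<close>

definition odds :: "nat \<Rightarrow> real \<Rightarrow> real \<Rightarrow> real" where
  "odds p q s = q * s * (1 - s) ^ (p - 1) / (q * (1 - s) ^ p + (1 - q))"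

text \<open>
  For \<open>H \<subseteq> second G \<inter> others G\<close>, the weight \<open>tilted p n lam s H G\<close> is that of a product measure
  under which, outside \<open>H\<close>, the second graph is independent of the others. It agrees with the
  true probability of \<open>G\<close> when \<open>H\<close> is exactly \<open>second G \<inter> others G\<close>, and unlike the latter it is
  invariant when an automorphism of \<open>H\<close> acts on the second graph alone.
\<close>

definition tilted :: "nat \<Rightarrow> nat \<Rightarrow> real \<Rightarrow> real \<Rightarrow> nat set set \<Rightarrow> (nat \<Rightarrow> nat set \<Rightarrow> bool) \<Rightarrow> real" where
  "tilted p n lam s H G = odds p (lam / real n) s ^ card (second G - H)
     * pmf (correlated_ER p n lam s) (G(2 := \<lambda>e. e \<in> H))"

text \<open>Inclusion replaces equality with the intersection: equality may be destroyed when an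
  automorphism of \<open>H\<close> moves the second graph alone, whereas inclusion survives.\<close>

definition containing :: "nat \<Rightarrow> nat \<Rightarrow> nat set set \<Rightarrow> (nat \<Rightarrow> nat set \<Rightarrow> bool) set" where
  "containing p n H = {G \<in> observations p n. H \<subseteq> second G \<inter> others G}"

lemma second_subset: "G \<in> observations p n \<Longrightarrow> second G \<subseteq> edges n"
  by (auto simp: observations_def second_def)

lemma replace_second_in_observations:
  "G \<in> observations p n \<Longrightarrow> p \<ge> 2 \<Longrightarrow> H \<subseteq> edges n \<Longrightarrow> G(2 := \<lambda>e. e \<in> H) \<in> observations p n"
  by (auto simp: observations_def split: if_splits)

text \<open>Edge by edge: an edge of the second graph that is not shared lies in no other graph, so
  deleting it trades a factor \<open>odds\<close> against the empty configuration; all other edges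
  are left as they are.\<close>

lemma pmf_eq_tilted:
  assumes G: "G \<in> observations p n" and p: "p \<ge> 2"
    and q: "0 \<le> lam / real n" "lam / real n < 1" and s: "0 \<le> s" "s \<le> 1"
  shows "pmf (correlated_ER p n lam s) G = tilted p n lam s (second G \<inter> others G) G"
proof -
  define q where "q = lam / real n"
  have q01: "0 \<le> q" "q \<le> 1" "q < 1"
    using q by (auto simp: q_def)
  let ?H = "second G \<inter> others G" and ?w = "pmf (edge_law p q s)"
  have sub: "second G \<subseteq> edges n"
    by (rule second_subset[OF G])
  have pos: "q * (1 - s) ^ p + (1 - q) > 0"
    using q01 s by (intro add_nonneg_pos) auto
  have single: "?w (\<lambda>i. i = 2) = odds p q s * ?w (\<lambda>_. False)"
    unfolding pmf_edge_law_single[OF q01(1,2) s p] pmf_edge_law_none[OF q01(1,2) s] odds_def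
    using pos by simp
  have e: "?w (\<lambda>i. G i e) = (if e \<in> second G - ?H then odds p q s else 1) * ?w (\<lambda>i. (G(2 := \<lambda>e. e \<in> ?H)) i e)" for e
  proof (cases "e \<in> second G - ?H")
    case True
    then have "(\<lambda>i. G i e) = (\<lambda>i. i = 2)" "(\<lambda>i. (G(2 := \<lambda>e. e \<in> ?H)) i e) = (\<lambda>_. False)"
      by (auto simp: second_def others_def fun_eq_iff)
    then show ?thesis
      using True single by simp
  next
    case False
    then have "(\<lambda>i. (G(2 := \<lambda>e. e \<in> ?H)) i e) = (\<lambda>i. G i e)"
      by (auto simp: second_def others_def fun_eq_iff)
    then show ?thesis
      using False by simp
  qed
  have "pmf (correlated_ER p n lam s) G = (\<Prod>e\<in>edges n. ?w (\<lambda>i. G i e))"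
    using pmf_correlated_ER[OF G] by (simp add: q_def)
  also have "\<dots> = (\<Prod>e\<in>edges n. (if e \<in> second G - ?H then odds p q s else 1)
      * ?w (\<lambda>i. (G(2 := \<lambda>e. e \<in> ?H)) i e))"
    by (intro prod.cong refl e)
  also have "\<dots> = (\<Prod>e\<in>edges n. if e \<in> second G - ?H then odds p q s else 1)
      * (\<Prod>e\<in>edges n. ?w (\<lambda>i. (G(2 := \<lambda>e. e \<in> ?H)) i e))"
    by (rule prod.distrib)
  also have "(\<Prod>e\<in>edges n. ?w (\<lambda>i. (G(2 := \<lambda>e. e \<in> ?H)) i e)) =
      pmf (correlated_ER p n lam s) (G(2 := \<lambda>e. e \<in> ?H))"
    unfolding q_def
    by (intro pmf_correlated_ER[symmetric] replace_second_in_observations[OF G p]) (use sub in blast)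
  also have "(\<Prod>e\<in>edges n. if e \<in> second G - ?H then odds p q s else 1) = (\<Prod>e\<in>second G - ?H. odds p q s)"
    unfolding prod.inter_restrict[OF finite_edges, symmetric] using sub
    by (simp only: Int_absorb1 Diff_subset[THEN subset_trans])
  finally show ?thesis
    by (simp add: tilted_def q_def fun_upd_def)
qed

lemma odds_nonneg: "0 \<le> q \<Longrightarrow> q \<le> 1 \<Longrightarrow> 0 \<le> s \<Longrightarrow> s \<le> 1 \<Longrightarrow> 0 \<le> odds p q s"
  by (simp add: odds_def)

text \<open>By independence across edges: those of \<open>H\<close> must be shared, and the others
  must be missing from the second graph.\<close>

lemma prob_second_eq_le:
  assumes q: "0 \<le> lam / real n" "lam / real n \<le> 1" and s: "0 \<le> s" "s \<le> 1" and p: "p \<ge> 2"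
    and H: "H \<subseteq> edges n"
  shows "measure_pmf.prob (correlated_ER p n lam s) {G. second G = H \<and> H \<subseteq> others G}
    \<le> (lam / real n * s * (1 - (1 - s) ^ (p - 1))) ^ card H * (1 - lam / real n * s) ^ card (edges n - H)"
proof -
  let ?e = "edge_law p (lam / real n) s"
  let ?B = "\<lambda>e. if e \<in> H then {x. x 2 \<and> (\<exists>i. i \<noteq> 2 \<and> x i)} else {x :: nat \<Rightarrow> bool. \<not> x 2}"
  have "measure_pmf.prob (correlated_ER p n lam s) {G. second G = H \<and> H \<subseteq> others G} \<le>
     measure_pmf.prob (Pi_pmf (edges n) (\<lambda>_. False) (\<lambda>_. ?e)) (Pi (edges n) ?B)"
    unfolding correlated_ER_eq_map measure_map_pmf
    by (intro measure_pmf.finite_measure_mono) (auto simp: second_def others_def)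
  also have "\<dots> = (\<Prod>e\<in>edges n. measure_pmf.prob ?e (?B e))"
    by (rule measure_Pi_pmf_Pi) simp
  also have "\<dots> = (\<Prod>e\<in>edges n. if e \<in> H then lam / real n * s * (1 - (1 - s) ^ (p - 1)) else 1 - lam / real n * s)"
    using prob_edge_law_shared[OF q s p] prob_edge_law_not_second[OF q s p]
    by (intro prod.cong) auto
  also have "\<dots> = (lam / real n * s * (1 - (1 - s) ^ (p - 1))) ^ card H * (1 - lam / real n * s) ^ card (edges n - H)"
    using H by (subst prod.If_cases) (auto simp: Int_absorb1 Diff_eq Collect_neg_eq)
  finally show ?thesis .
qed

text \<open>\<open>G\<close> is encoded by its second graph together with \<open>G\<close> after
  shrinking that graph to \<open>H\<close>. The weight is a product over this pair: the first factor
  sums over supersets of \<open>H\<close> to a power of \<open>1 + odds\<close>, the second to a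
  probability.\<close>

lemma sum_tilted_le:
  assumes q: "0 \<le> lam / real n" "lam / real n \<le> 1" and s: "0 \<le> s" "s \<le> 1" and p: "p \<ge> 2"
    and H: "H \<subseteq> edges n"
  shows "(\<Sum>G\<in>containing p n H. tilted p n lam s H G) \<le>
     (lam / real n * s * (1 - (1 - s) ^ (p - 1))) ^ card H *
     ((1 + odds p (lam / real n) s) * (1 - lam / real n * s)) ^ card (edges n - H)"
proof -
  let ?t = "odds p (lam / real n) s"
  let ?A = "{A. A \<subseteq> edges n \<and> H \<subseteq> A}"
  let ?B = "{G \<in> observations p n. second G = H \<and> H \<subseteq> others G}"
  let ?f = "\<lambda>G. (second G, G(2 := \<lambda>e. e \<in> H))"
  let ?P = "pmf (correlated_ER p n lam s)"
  have t: "0 \<le> ?t"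
    by (rule odds_nonneg[OF q s])
  have inj: "inj_on ?f (containing p n H)"
  proof (rule inj_onI)
    fix G G' assume *: "?f G = ?f G'"
    have "G i e = G' i e" for i e
    proof (cases "i = 2")
      case True
      then show ?thesis
        using * by (auto simp: second_def set_eq_iff)
    next
      case False
      then show ?thesis
        using * by (metis fun_upd_other snd_conv)
    qed
    then show "G = G'"
      by (simp add: fun_eq_iff)
  qed
  have img: "?f ` containing p n H \<subseteq> ?A \<times> ?B"
  proof
    fix x assume "x \<in> ?f ` containing p n H"
    then obtain G where G: "G \<in> containing p n H" "x = ?f G"
      by blast
    have "G(2 := \<lambda>e. e \<in> H) \<in> observations p n"
      using G p H by (intro replace_second_in_observations) (auto simp: containing_def)
    moreover have "second (G(2 := \<lambda>e. e \<in> H)) = H" "others (G(2 := \<lambda>e. e \<in> H)) = others G"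
      by (auto simp: second_def others_def)
    ultimately show "x \<in> ?A \<times> ?B"
      using G second_subset[of G p n] by (auto simp: containing_def)
  qed
  have fin: "finite ?A" "finite ?B"
    by auto
  have "(\<Sum>G\<in>containing p n H. tilted p n lam s H G) =
     (\<Sum>(A, B)\<in>?f ` containing p n H. ?t ^ card (A - H) * ?P B)"
    by (subst sum.reindex[OF inj]) (simp add: tilted_def)
  also have "\<dots> \<le> (\<Sum>(A, B)\<in>?A \<times> ?B. ?t ^ card (A - H) * ?P B)"
    using t by (intro sum_mono2 img) (auto simp: fin)
  also have "\<dots> = (\<Sum>A\<in>?A. ?t ^ card (A - H)) * (\<Sum>B\<in>?B. ?P B)"
    by (simp add: sum_product sum.cartesian_product)
  also have "(\<Sum>A\<in>?A. ?t ^ card (A - H)) = (1 + ?t) ^ card (edges n - H)"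
    using sum_supersets_binomial[OF finite_edges H, of ?t 1] by (simp add: add.commute)
  also have "(\<Sum>B\<in>?B. ?P B) = measure_pmf.prob (correlated_ER p n lam s) ?B"
    by (rule measure_measure_pmf_finite[symmetric]) simp
  also have "\<dots> \<le> measure_pmf.prob (correlated_ER p n lam s) {G. second G = H \<and> H \<subseteq> others G}"
    by (intro measure_pmf.finite_measure_mono) auto
  also have "\<dots> \<le> (lam / real n * s * (1 - (1 - s) ^ (p - 1))) ^ card H
      * (1 - lam / real n * s) ^ card (edges n - H)"
    by (rule prob_second_eq_le[OF assms])
  finally show ?thesis
    using t by (simp add: mult_left_mono power_mult_distrib mult_ac)
qed

section \<open>Symmetrization by automorphisms of the shared graph\<close>

definition relabel_second ::
  "(nat \<Rightarrow> nat) \<Rightarrow> (nat \<Rightarrow> nat set \<Rightarrow> bool) \<times> (nat \<Rightarrow> nat \<Rightarrow> nat)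
     \<Rightarrow> (nat \<Rightarrow> nat set \<Rightarrow> bool) \<times> (nat \<Rightarrow> nat \<Rightarrow> nat)" where
  "relabel_second \<sigma> = (\<lambda>(G, \<pi>). (G(2 := \<lambda>e. G 2 (\<sigma> ` e)), \<pi>(2 := \<pi> 2 \<circ> \<sigma>)))"

text \<open>For \<open>p \<ge> 2\<close> this dominates \<open>n\<close> times the overlap, since
  agreement at all indices requires agreement at index 2.\<close>

definition agreement ::
  "((nat \<Rightarrow> nat set \<Rightarrow> bool) \<Rightarrow> nat \<Rightarrow> nat \<Rightarrow> nat) \<Rightarrow> nat \<Rightarrow> nat
     \<Rightarrow> (nat \<Rightarrow> nat set \<Rightarrow> bool) \<Rightarrow> (nat \<Rightarrow> nat \<Rightarrow> nat) \<Rightarrow> nat" where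
  "agreement f p n G \<pi> = card {u \<in> {1..n}. f (observation p n G \<pi>) 2 u = \<pi> 2 u}"

text \<open>The inverse of \<open>\<pi> 2 \<circ> \<sigma>\<close> ends with
  \<open>inv \<sigma>\<close>, which the pullback of the second graph by \<sigma> cancels.\<close>

lemma observation_relabel_second:
  assumes "\<sigma> permutes {1..n}" "\<pi> 2 permutes {1..n}"
  shows "observation p n (G(2 := \<lambda>e. G 2 (\<sigma> ` e))) (\<pi>(2 := \<pi> 2 \<circ> \<sigma>)) = observation p n G \<pi>"
proof -
  have "inv (\<pi> 2 \<circ> \<sigma>) = inv \<sigma> \<circ> inv (\<pi> 2)"
    using assms by (intro o_inv_distrib permutes_bij)
  then have "\<sigma> ` inv (\<pi> 2 \<circ> \<sigma>) ` e = inv (\<pi> 2) ` e" for e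
    using permutes_inverses[OF assms(1)] by (simp add: image_image)
  then show ?thesis
    by (auto simp: observation_def fun_eq_iff)
qed

text \<open>The observation, hence the guess, stays the same while the target varies with \<sigma>.
  So \<open>u\<close> is guessed correctly exactly when \<sigma> sends it to a vertex that does not
  depend on \<sigma>.\<close>

lemma agreement_relabel_second:
  assumes "\<sigma> permutes {1..n}" "\<pi> 2 permutes {1..n}"
  shows "agreement f p n (G(2 := \<lambda>e. G 2 (\<sigma> ` e))) (\<pi>(2 := \<pi> 2 \<circ> \<sigma>)) =
    card {u \<in> {1..n}. \<sigma> u = inv (\<pi> 2) (f (observation p n G \<pi>) 2 u)}"
proof -
  have "(f (observation p n G \<pi>) 2 u = \<pi> 2 (\<sigma> u)) \<longleftrightarrow> (\<sigma> u = inv (\<pi> 2) (f (observation p n G \<pi>) 2 u))" for u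
    using permutes_inverses[OF assms(2)] by metis
  then show ?thesis
    using observation_relabel_second[of \<sigma> n \<pi> p G] assms by (simp add: agreement_def)
qed

text \<open>For each \<open>u\<close> the required image is fixed, so the orbit-stabilizer bound
  limits the automorphisms under which the guess at \<open>u\<close> is right.\<close>

lemma sum_agreement_le:
  assumes "\<pi> 2 permutes {1..n}"
  shows "(\<Sum>\<sigma>\<in>graph_auts n H. real (agreement f p n (G(2 := \<lambda>e. G 2 (\<sigma> ` e))) (\<pi>(2 := \<pi> 2 \<circ> \<sigma>))))
    \<le> real (card (graph_auts n H)) * (\<Sum>u\<in>{1..n}. 1 / real (card (orbit n H u)))"
proof -
  define g where "g u = inv (\<pi> 2) (f (observation p n G \<pi>) 2 u)" for u
  have "(\<Sum>\<sigma>\<in>graph_auts n H. real (agreement f p n (G(2 := \<lambda>e. G 2 (\<sigma> ` e))) (\<pi>(2 := \<pi> 2 \<circ> \<sigma>)))) =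
     (\<Sum>\<sigma>\<in>graph_auts n H. \<Sum>u\<in>{1..n}. if \<sigma> u = g u then 1 else 0)"
  proof (intro sum.cong refl)
    fix \<sigma> assume "\<sigma> \<in> graph_auts n H"
    then have "agreement f p n (G(2 := \<lambda>e. G 2 (\<sigma> ` e))) (\<pi>(2 := \<pi> 2 \<circ> \<sigma>)) = card {u \<in> {1..n}. \<sigma> u = g u}"
      unfolding g_def by (intro agreement_relabel_second assms) (simp add: graph_auts_def)
    then show "real (agreement f p n (G(2 := \<lambda>e. G 2 (\<sigma> ` e))) (\<pi>(2 := \<pi> 2 \<circ> \<sigma>))) =
        (\<Sum>u\<in>{1..n}. if \<sigma> u = g u then 1 else 0)"
      by (simp add: sum.inter_filter[symmetric])
  qed
  also have "\<dots> = (\<Sum>u\<in>{1..n}. \<Sum>\<sigma>\<in>graph_auts n H. if \<sigma> u = g u then 1 else 0)"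
    by (rule sum.swap)
  also have "\<dots> = (\<Sum>u\<in>{1..n}. real (card {\<sigma> \<in> graph_auts n H. \<sigma> u = g u}))"
    by (simp add: sum.inter_filter[symmetric])
  also have "\<dots> \<le> (\<Sum>u\<in>{1..n}. real (card (graph_auts n H)) / real (card (orbit n H u)))"
    by (intro sum_mono orbit_stabilizer_le)
  finally show ?thesis
    by (simp add: sum_distrib_left)
qed

text \<open>An automorphism of \<open>H\<close> maps the complement of \<open>H\<close> to itself,
  so the number of edges of the second graph outside \<open>H\<close> is kept; the other factor
  forgets the second graph altogether.\<close>

lemma tilted_relabel_second:
  assumes "\<sigma> \<in> graph_auts n H"
  shows "tilted p n lam s H (G(2 := \<lambda>e. G 2 (\<sigma> ` e))) = tilted p n lam s H G"
proof -
  have \<sigma>: "\<sigma> permutes {1..n}" "(`) \<sigma> ` H = H"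
    using assms by (auto simp: graph_auts_def)
  have inj: "inj ((`) \<sigma>)"
    using permutes_inj[OF \<sigma>(1)] by (simp add: inj_def inj_image_eq_iff)
  have memH: "\<sigma> ` e \<in> H \<longleftrightarrow> e \<in> H" for e
    using \<sigma>(2) inj by (metis inj_image_mem_iff)
  have "second (G(2 := \<lambda>e. G 2 (\<sigma> ` e))) - H = (`) \<sigma> -` (second G - H)"
    by (auto simp: second_def memH)
  moreover have "card ((`) \<sigma> -` (second G - H)) = card (second G - H)"
  proof (rule card_vimage_inj[OF inj])
    show "second G - H \<subseteq> range ((`) \<sigma>)"
      using inv_image_image(2)[OF \<sigma>(1)] by (metis rangeI subsetI)
  qed
  ultimately show ?thesis
    by (simp add: tilted_def)
qed

lemma bij_betw_relabel_second:
  assumes \<sigma>: "\<sigma> \<in> graph_auts n H" and p: "p \<ge> 2"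
  shows "bij_betw (relabel_second \<sigma>) (containing p n H \<times> alignments p n) (containing p n H \<times> alignments p n)"
proof -
  let ?X = "containing p n H \<times> alignments p n"
  have perm: "\<sigma> permutes {1..n}" and H: "(`) \<sigma> ` H = H"
    using \<sigma> by (auto simp: graph_auts_def)
  have "inj_on (relabel_second \<sigma>) ?X"
  proof (rule inj_onI, clarify)
    fix G \<pi> G' \<pi>'
    assume "relabel_second \<sigma> (G, \<pi>) = relabel_second \<sigma> (G', \<pi>')"
    then have eq: "G(2 := \<lambda>e. G 2 (\<sigma> ` e)) = G'(2 := \<lambda>e. G' 2 (\<sigma> ` e))"
        "\<pi>(2 := \<pi> 2 \<circ> \<sigma>) = \<pi>'(2 := \<pi>' 2 \<circ> \<sigma>)"
      by (auto simp: relabel_second_def)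
    have "G i e = G' i e" for i e
    proof (cases "i = 2")
      case True
      have "G 2 (\<sigma> ` inv \<sigma> ` e) = G' 2 (\<sigma> ` inv \<sigma> ` e)"
        using fun_cong[OF fun_cong[OF eq(1), of 2], of "inv \<sigma> ` e"] by simp
      then show ?thesis
        using True inv_image_image(2)[OF perm] by simp
    next
      case False
      then show ?thesis
        using eq(1) by (metis fun_upd_other)
    qed
    moreover have "\<pi> i u = \<pi>' i u" for i u
    proof (cases "i = 2")
      case True
      have "\<pi> 2 (\<sigma> (inv \<sigma> u)) = \<pi>' 2 (\<sigma> (inv \<sigma> u))"
        using fun_cong[OF fun_cong[OF eq(2), of 2], of "inv \<sigma> u"] by simp
      then show ?thesis
        using True permutes_inverses(1)[OF perm] by simp
    next
      case False
      then show ?thesis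
        using eq(2) by (metis fun_upd_other)
    qed
    ultimately show "G = G' \<and> \<pi> = \<pi>'"
      by (simp add: fun_eq_iff)
  qed
  moreover have "relabel_second \<sigma> ` ?X \<subseteq> ?X"
  proof
    fix x assume "x \<in> relabel_second \<sigma> ` ?X"
    then obtain G \<pi> where x: "G \<in> containing p n H" "\<pi> \<in> alignments p n"
        "x = (G(2 := \<lambda>e. G 2 (\<sigma> ` e)), \<pi>(2 := \<pi> 2 \<circ> \<sigma>))"
      by (auto simp: relabel_second_def)
    have "\<pi> 2 permutes {1..n}"
      using x(2) p by (simp add: alignments_def)
    then have "\<pi> 2 \<circ> \<sigma> permutes {1..n}"
      by (rule permutes_compose[OF perm])
    then have "\<pi>(2 := \<pi> 2 \<circ> \<sigma>) \<in> alignments p n"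
      using x(2) p by (auto simp: alignments_def)
    moreover have "G(2 := \<lambda>e. G 2 (\<sigma> ` e)) \<in> observations p n"
      using x(1) image_mem_edges_iff[OF perm] p by (auto simp: containing_def observations_def)
    moreover have "\<sigma> ` e \<in> H" if "e \<in> H" for e
      using H that by blast
    ultimately show "x \<in> ?X"
      using x(1,3) by (auto simp: containing_def second_def others_def)
  qed
  moreover have "finite ?X"
    by (auto simp: containing_def)
  ultimately show ?thesis
    by (simp add: bij_betw_def endo_inj_surj)
qed

lemma tilted_nonneg:
  assumes "0 \<le> lam / real n" "lam / real n \<le> 1" "0 \<le> s" "s \<le> 1"
  shows "0 \<le> tilted p n lam s H G"
  using odds_nonneg[OF assms] by (simp add: tilted_def)

text \<open>Averaging over the automorphism group: relabelling permutes the index set and keeps both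
  weights, so only the agreement gets averaged.\<close>

lemma sum_tilted_agreement_le:
  assumes q: "0 \<le> lam / real n" "lam / real n \<le> 1" and s: "0 \<le> s" "s \<le> 1" and p: "p \<ge> 2"
  shows "(\<Sum>(G, \<pi>)\<in>containing p n H \<times> alignments p n.
      tilted p n lam s H G * pmf (random_alignment p n) \<pi> * real (agreement f p n G \<pi>))
    \<le> (\<Sum>u\<in>{1..n}. 1 / real (card (orbit n H u))) * (\<Sum>G\<in>containing p n H. tilted p n lam s H G)"
proof -
  let ?X = "containing p n H \<times> alignments p n"
  let ?T = "tilted p n lam s H" and ?R = "pmf (random_alignment p n)"
  let ?Z = "\<Sum>u\<in>{1..n}. 1 / real (card (orbit n H u))"
  define N where "N = real (card (graph_auts n H))"
  have N: "N > 0"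
    using graph_auts_nonempty[of n H] by (simp add: N_def card_gt_0_iff)
  define F where "F = (\<lambda>(G, \<pi>). ?T G * ?R \<pi> * real (agreement f p n G \<pi>))"
  \<comment> \<open>One copy of the sum per automorphism, so that each copy can be reindexed by its
    own relabelling.\<close>
  have "N * (\<Sum>x\<in>?X. F x) = (\<Sum>\<sigma>\<in>graph_auts n H. \<Sum>x\<in>?X. F x)"
    by (simp add: N_def)
  also have "\<dots> = (\<Sum>\<sigma>\<in>graph_auts n H. \<Sum>x\<in>?X. F (relabel_second \<sigma> x))"
    by (intro sum.cong refl sum.reindex_bij_betw[symmetric] bij_betw_relabel_second p)
  also have "\<dots> = (\<Sum>x\<in>?X. \<Sum>\<sigma>\<in>graph_auts n H. F (relabel_second \<sigma> x))"
    by (rule sum.swap)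
  also have "\<dots> \<le> (\<Sum>(G, \<pi>)\<in>?X. N * ?Z * (?T G * ?R \<pi>))"
  proof (rule sum_mono, clarify)
    fix G \<pi> assume G: "G \<in> containing p n H" and \<pi>: "\<pi> \<in> alignments p n"
    have \<pi>2: "\<pi> 2 permutes {1..n}"
      using \<pi> p by (simp add: alignments_def)
    have "F (relabel_second \<sigma> (G, \<pi>)) = ?T G * ?R \<pi> *
        real (agreement f p n (G(2 := \<lambda>e. G 2 (\<sigma> ` e))) (\<pi>(2 := \<pi> 2 \<circ> \<sigma>)))"
      if \<sigma>: "\<sigma> \<in> graph_auts n H" for \<sigma>
    proof -
      have "relabel_second \<sigma> (G, \<pi>) \<in> ?X"
        using bij_betw_imp_surj_on[OF bij_betw_relabel_second[OF \<sigma> p]] G \<pi> by blast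
      then have "\<pi>(2 := \<pi> 2 \<circ> \<sigma>) \<in> alignments p n"
        by (simp add: relabel_second_def)
      then have "?R (\<pi>(2 := \<pi> 2 \<circ> \<sigma>)) = ?R \<pi>"
        using \<pi> by (simp add: pmf_random_alignment)
      then show ?thesis
        using tilted_relabel_second[OF \<sigma>] by (simp add: F_def relabel_second_def)
    qed
    then have "(\<Sum>\<sigma>\<in>graph_auts n H. F (relabel_second \<sigma> (G, \<pi>))) = ?T G * ?R \<pi> *
      (\<Sum>\<sigma>\<in>graph_auts n H. real (agreement f p n (G(2 := \<lambda>e. G 2 (\<sigma> ` e))) (\<pi>(2 := \<pi> 2 \<circ> \<sigma>))))"
      by (simp add: sum_distrib_left)
    also have "\<dots> \<le> ?T G * ?R \<pi> * (N * ?Z)"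
      unfolding N_def using tilted_nonneg[OF q s]
      by (intro mult_left_mono sum_agreement_le \<pi>2) auto
    finally show "(\<Sum>\<sigma>\<in>graph_auts n H. F (relabel_second \<sigma> (G, \<pi>))) \<le> N * ?Z * (?T G * ?R \<pi>)"
      by (simp only: mult_ac)
  qed
  also have "\<dots> = N * ?Z * ((\<Sum>G\<in>containing p n H. ?T G) * (\<Sum>\<pi>\<in>alignments p n. ?R \<pi>))"
    unfolding sum_product sum.cartesian_product sum_distrib_left[of "N * ?Z"]
    by (simp only: case_prod_unfold)
  also have "(\<Sum>\<pi>\<in>alignments p n. ?R \<pi>) = 1"
    by (rule sum_pmf_eq_1[OF finite_alignments set_pmf_random_alignment])
  finally have "N * (\<Sum>x\<in>?X. F x) \<le> N * (?Z * (\<Sum>G\<in>containing p n H. ?T G))"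
    by (simp add: mult.assoc)
  then show ?thesis
    using N by (simp add: F_def)
qed

text \<open>The graphs are sorted by their shared graph \<open>H\<close>, on which class the true
  law equals the tilted weight; the class is then enlarged until it is invariant under
  relabelling.\<close>

lemma expected_agreement_le:
  assumes q: "0 \<le> lam / real n" "lam / real n < 1" and s: "0 \<le> s" "s \<le> 1" and p: "p \<ge> 2"
  shows "(\<Sum>(G, \<pi>)\<in>observations p n \<times> alignments p n.
      pmf (alignment_model p n lam s) (G, \<pi>) * real (agreement f p n G \<pi>))
    \<le> (\<Sum>H\<in>Pow (edges n). (\<Sum>u\<in>{1..n}. 1 / real (card (orbit n H u))) *
         (\<Sum>G\<in>containing p n H. tilted p n lam s H G))"
proof -
  let ?C = "pmf (correlated_ER p n lam s)" and ?R = "pmf (random_alignment p n)"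
  let ?T = "tilted p n lam s" and ?g = "\<lambda>G. second G \<inter> others G"
  define g where "g G = (\<Sum>\<pi>\<in>alignments p n. ?R \<pi> * real (agreement f p n G \<pi>))" for G
  have g: "0 \<le> g G" for G
    by (auto simp: g_def intro!: sum_nonneg)
  have T: "0 \<le> ?T H G" for H G
    using tilted_nonneg q s by simp
  have "(\<Sum>(G, \<pi>)\<in>observations p n \<times> alignments p n.
      pmf (alignment_model p n lam s) (G, \<pi>) * real (agreement f p n G \<pi>)) =
      (\<Sum>G\<in>observations p n. ?C G * g G)"
    by (simp add: sum.cartesian_product[symmetric] alignment_model_def pmf_pair g_def
        sum_distrib_left mult.assoc)
  also have "\<dots> = (\<Sum>G\<in>observations p n. ?T (?g G) G * g G)"
    using pmf_eq_tilted[OF _ p q s] by simp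
  also have "\<dots> = (\<Sum>H\<in>Pow (edges n). \<Sum>G | G \<in> observations p n \<and> ?g G = H. ?T (?g G) G * g G)"
    by (intro sum.group[symmetric]) (use second_subset in auto)
  also have "\<dots> \<le> (\<Sum>H\<in>Pow (edges n). \<Sum>G\<in>containing p n H. ?T H G * g G)"
  proof (rule sum_mono)
    fix H
    have "(\<Sum>G | G \<in> observations p n \<and> ?g G = H. ?T (?g G) G * g G) =
        (\<Sum>G | G \<in> observations p n \<and> ?g G = H. ?T H G * g G)"
      by (intro sum.cong) auto
    \<comment> \<open>Here the constraint that no edge outside \<open>H\<close> be shared is
      dropped.\<close>
    also have "\<dots> \<le> (\<Sum>G\<in>containing p n H. ?T H G * g G)"
      using T g by (intro sum_mono2) (auto simp: containing_def)
    finally show "(\<Sum>G | G \<in> observations p n \<and> ?g G = H. ?T (?g G) G * g G) \<le> \<dots>" .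
  qed
  also have "\<dots> \<le> (\<Sum>H\<in>Pow (edges n). (\<Sum>u\<in>{1..n}. 1 / real (card (orbit n H u))) *
         (\<Sum>G\<in>containing p n H. ?T H G))"
  proof (rule sum_mono)
    fix H
    have "(\<Sum>G\<in>containing p n H. ?T H G * g G) =
      (\<Sum>(G, \<pi>)\<in>containing p n H \<times> alignments p n. ?T H G * ?R \<pi> * real (agreement f p n G \<pi>))"
      by (simp add: sum.cartesian_product[symmetric] g_def sum_distrib_left mult.assoc)
    also have "\<dots> \<le> (\<Sum>u\<in>{1..n}. 1 / real (card (orbit n H u))) * (\<Sum>G\<in>containing p n H. ?T H G)"
      using q s p by (intro sum_tilted_agreement_le) auto
    finally show "(\<Sum>G\<in>containing p n H. ?T H G * g G) \<le> \<dots>" .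
  qed
  finally show ?thesis .
qed

section \<open>Quantitative cost of dropping the constraint\<close>

text \<open>Off \<open>H\<close>, the tilted weight contributes the left side per edge, while an
  Erdos--Renyi law for \<open>H\<close> would contribute the first factor on the right. They differ
  by at most \<open>2 * q\<^sup>2\<close>, small enough to be harmless over order
  \<open>n\<^sup>2\<close> edges.\<close>

lemma odds_product_le:
  assumes q: "0 \<le> q" "q \<le> 1 / 2" and s: "0 \<le> s" "s \<le> 1" and p: "p \<ge> 2"
  shows "(1 + odds p q s) * (1 - q * s) \<le> (1 - q * s * (1 - (1 - s) ^ (p - 1))) * exp (4 * q\<^sup>2)"
proof -
  define r where "r = (1 - s) ^ (p - 1)"
  have r: "0 \<le> r" "r \<le> 1"
    using s by (auto simp: r_def power_le_one)
  have sp: "(1 - s) ^ p = (1 - s) * r"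
    using p by (cases p) (auto simp: r_def)
  define z where "z = q * ((1 - s) * r) + (1 - q)"
  have z: "1 / 2 \<le> z"
  proof -
    have "0 \<le> q * ((1 - s) * r)"
      using q s r by simp
    then show ?thesis
      using q by (simp add: z_def)
  qed
  define t where "t = odds p q s"
  have tz: "t * z = q * s * r"
    using z by (simp add: t_def odds_def sp z_def r_def)
  have qsr: "0 \<le> q * s * r" "q * s * r \<le> q"
    using q s r by (auto simp: mult_left_le mult_le_one mult.assoc intro!: mult_nonneg_nonneg)
  have t: "0 \<le> t"
    using odds_nonneg q s by (simp add: t_def)
  have "t * (1 / 2) \<le> t * z"
    by (rule mult_left_mono[OF z t])
  then have t2: "t \<le> 2 * q"
    using tz qsr by simp
  have d: "0 \<le> q * (1 - s) * (1 - r)" "q * (1 - s) * (1 - r) \<le> q"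
    using q s r by (auto simp: mult_left_le mult_le_one mult.assoc intro!: mult_nonneg_nonneg)
  \<comment> \<open>From \<open>1 - q * s = z + q * (1 - s) * (1 - r)\<close>: the product
    \<open>t * z\<close> is known exactly, and the remaining term is a product of two factors of
    order \<open>q\<close>.\<close>
  have "(1 + t) * (1 - q * s) = (1 - q * s) + t * z + t * (q * (1 - s) * (1 - r))"
    by (simp add: z_def algebra_simps)
  also have "\<dots> = (1 - q * s * (1 - r)) + t * (q * (1 - s) * (1 - r))"
    by (simp add: tz algebra_simps)
  also have "t * (q * (1 - s) * (1 - r)) \<le> (2 * q) * q"
    using t t2 d q by (intro mult_mono) auto
  \<comment> \<open>The additive error becomes multiplicative because \<open>q \<le> 1 / 2\<close>
    keeps the factor \<open>1 - q * s * (1 - r)\<close> at least \<open>1 / 2\<close>.\<close>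
  also have "(2 * q) * q \<le> (1 - q * s * (1 - r)) * (4 * q\<^sup>2)"
  proof -
    have "s * (1 - r) \<le> 1"
      using s r by (intro mult_le_one) auto
    then have "q * s * (1 - r) \<le> q"
      using q by (simp add: mult.assoc mult_left_le)
    then have "1 / 2 * (4 * q\<^sup>2) \<le> (1 - q * s * (1 - r)) * (4 * q\<^sup>2)"
      using q by (intro mult_right_mono) auto
    then show ?thesis
      by (simp add: power2_eq_square)
  qed
  finally have "(1 + t) * (1 - q * s) \<le> (1 - q * s * (1 - r)) * (1 + 4 * q\<^sup>2)"
    by (simp add: algebra_simps)
  also have "\<dots> \<le> (1 - q * s * (1 - r)) * exp (4 * q\<^sup>2)"
  proof (rule mult_left_mono[OF exp_ge_add_one_self])
    have "q * (s * (1 - r)) \<le> 1 * 1"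
      using q s r by (intro mult_mono mult_le_one mult_nonneg_nonneg) auto
    then show "0 \<le> 1 - q * s * (1 - r)"
      by (simp add: mult.assoc)
  qed
  finally show ?thesis
    by (simp add: t_def r_def)
qed

text \<open>The constant \<open>exp (4 * lam\<^sup>2)\<close> collects
  \<open>exp (4 * q\<^sup>2)\<close> over at most \<open>n\<^sup>2\<close> edges, and
  \<open>2 * lam \<le> n\<close> ensures \<open>q \<le> 1 / 2\<close>. What remains is the expected
  number of orbits of an Erdos--Renyi graph of edge probability \<open>a\<close>.\<close>

lemma expected_agreement_bound:
  assumes lam: "0 < lam" and s: "0 \<le> s" "s \<le> 1" and p: "p \<ge> 2"
    and sub: "lam * s * (1 - (1 - s) ^ (p - 1)) < 1"
    and n: "n > 0" "2 * lam \<le> real n" and K: "K > 0"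
  shows "(\<Sum>(G, \<pi>)\<in>observations p n \<times> alignments p n.
      pmf (alignment_model p n lam s) (G, \<pi>) * real (agreement f p n G \<pi>))
    \<le> exp (4 * lam\<^sup>2) * (real (card (codes K)) +
         real n / (real K * (1 - lam * s * (1 - (1 - s) ^ (p - 1)))))"
proof -
  define q where "q = lam / real n"
  have q: "0 \<le> q" "q \<le> 1 / 2"
    using lam n by (auto simp: q_def field_simps)
  define a where "a = q * s * (1 - (1 - s) ^ (p - 1))"
  have na: "real n * a = lam * s * (1 - (1 - s) ^ (p - 1))"
    using n by (simp add: a_def q_def)
  have r: "0 \<le> 1 - (1 - s) ^ (p - 1)" "1 - (1 - s) ^ (p - 1) \<le> 1"
    using s by (auto simp: power_le_one)
  have a: "0 \<le> a" "a \<le> 1"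
  proof -
    show "0 \<le> a"
      using q s r by (simp add: a_def)
    have "q * (s * (1 - (1 - s) ^ (p - 1))) \<le> 1 * 1"
      using q s r by (intro mult_mono mult_le_one mult_nonneg_nonneg) auto
    then show "a \<le> 1"
      by (simp add: a_def mult.assoc)
  qed
  let ?Z = "\<lambda>H. \<Sum>u\<in>{1..n}. 1 / real (card (orbit n H u))"
  have Z: "0 \<le> ?Z H" for H
    by (auto intro!: sum_nonneg)
  have pow: "((1 + odds p q s) * (1 - q * s)) ^ card (edges n - H) \<le>
      exp (4 * lam\<^sup>2) * (1 - a) ^ card (edges n - H)" for H
  proof -
    have nn: "0 \<le> (1 + odds p q s) * (1 - q * s)"
    proof -
      have "q * s \<le> 1 * 1"
        using q s by (intro mult_mono) auto
      moreover have "0 \<le> odds p q s"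
        using q s by (intro odds_nonneg) auto
      ultimately show ?thesis
        by simp
    qed
    have "card (edges n - H) \<le> n\<^sup>2"
      using card_edges_le[of n] card_mono[of "edges n" "edges n - H"] by simp
    then have "real (card (edges n - H)) * q\<^sup>2 \<le> real (n\<^sup>2) * q\<^sup>2"
      by (intro mult_right_mono of_nat_mono) auto
    also have "\<dots> = lam\<^sup>2"
      using n by (simp add: q_def power_divide)
    finally have m: "real (card (edges n - H)) * (4 * q\<^sup>2) \<le> 4 * lam\<^sup>2"
      by simp
    have "((1 + odds p q s) * (1 - q * s)) ^ card (edges n - H) \<le>
        ((1 - a) * exp (4 * q\<^sup>2)) ^ card (edges n - H)"
      using odds_product_le[OF q s p] nn by (intro power_mono) (simp_all add: a_def)
    also have "\<dots> = exp (real (card (edges n - H)) * (4 * q\<^sup>2)) * (1 - a) ^ card (edges n - H)"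
      by (simp add: power_mult_distrib exp_of_nat_mult)
    also have "\<dots> \<le> exp (4 * lam\<^sup>2) * (1 - a) ^ card (edges n - H)"
      using m a by (intro mult_right_mono) auto
    finally show ?thesis .
  qed
  have "(\<Sum>(G, \<pi>)\<in>observations p n \<times> alignments p n.
      pmf (alignment_model p n lam s) (G, \<pi>) * real (agreement f p n G \<pi>))
    \<le> (\<Sum>H\<in>Pow (edges n). ?Z H * (\<Sum>G\<in>containing p n H. tilted p n lam s H G))"
    using q s p unfolding q_def by (intro expected_agreement_le) linarith+
  also have "\<dots> \<le> (\<Sum>H\<in>Pow (edges n). ?Z H *
      (exp (4 * lam\<^sup>2) * (a ^ card H * (1 - a) ^ card (edges n - H))))"
  proof (intro sum_mono mult_left_mono Z)
    fix H assume H: "H \<in> Pow (edges n)"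
    have q1: "0 \<le> lam / real n" "lam / real n \<le> 1"
      using q unfolding q_def by linarith+
    have "(\<Sum>G\<in>containing p n H. tilted p n lam s H G) \<le>
        a ^ card H * ((1 + odds p q s) * (1 - q * s)) ^ card (edges n - H)"
      using sum_tilted_le[OF q1 s p] H by (simp add: a_def q_def)
    also have "\<dots> \<le> a ^ card H * (exp (4 * lam\<^sup>2) * (1 - a) ^ card (edges n - H))"
      using a by (intro mult_left_mono pow) auto
    finally show "(\<Sum>G\<in>containing p n H. tilted p n lam s H G) \<le>
        exp (4 * lam\<^sup>2) * (a ^ card H * (1 - a) ^ card (edges n - H))"
      by (simp add: mult_ac)
  qed
  also have "\<dots> = exp (4 * lam\<^sup>2) *
      (\<Sum>H\<in>Pow (edges n). a ^ card H * (1 - a) ^ card (edges n - H) * ?Z H)"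
    unfolding sum_distrib_left by (intro sum.cong refl) (simp add: mult_ac sum_distrib_left)
  also have "\<dots> \<le> exp (4 * lam\<^sup>2) * (real (card (codes K)) + real n / (real K * (1 - real n * a)))"
    using sub na a K by (intro mult_left_mono expected_number_of_orbits_le) auto
  finally show ?thesis
    by (simp add: na)
qed

section \<open>Markov's inequality and passage to the limit\<close>

text \<open>Markov's inequality for \<open>agreement / n\<close>, which dominates the
  overlap.\<close>

lemma prob_overlap_le:
  assumes p: "p \<ge> 2" and n: "n > 0" and d: "0 < d"
  shows "measure_pmf.prob (alignment_model p n lam s)
      {(G, \<pi>). d \<le> overlap p n (f (observation p n G \<pi>)) \<pi>}
    \<le> (\<Sum>(G, \<pi>)\<in>observations p n \<times> alignments p n.
      pmf (alignment_model p n lam s) (G, \<pi>) * real (agreement f p n G \<pi>)) / (real n * d)"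
proof -
  let ?M = "alignment_model p n lam s" and ?X = "observations p n \<times> alignments p n"
  let ?B = "{(G, \<pi>). d \<le> overlap p n (f (observation p n G \<pi>)) \<pi>}"
  have set: "set_pmf ?M \<subseteq> ?X"
    unfolding alignment_model_def set_pair_pmf
    by (intro Sigma_mono set_pmf_correlated_ER set_pmf_random_alignment)
  have "measure_pmf.prob ?M ?B = measure_pmf.prob ?M (?B \<inter> set_pmf ?M)"
    by (simp add: measure_Int_set_pmf)
  also have "\<dots> \<le> measure_pmf.prob ?M (?B \<inter> ?X)"
    using set by (intro measure_pmf.finite_measure_mono) auto
  also have "\<dots> = (\<Sum>x\<in>?B \<inter> ?X. pmf ?M x)"
    by (intro measure_measure_pmf_finite) auto
  also have "\<dots> \<le> (\<Sum>(G, \<pi>)\<in>?B \<inter> ?X. pmf ?M (G, \<pi>) * real (agreement f p n G \<pi>) / (real n * d))"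
  proof (rule sum_mono, clarify)
    fix G \<pi>
    assume ov: "d \<le> overlap p n (f (observation p n G \<pi>)) \<pi>"
    have "card {u \<in> {1..n}. \<forall>i\<in>{2..p}. f (observation p n G \<pi>) i u = \<pi> i u} \<le> agreement f p n G \<pi>"
      unfolding agreement_def using p by (intro card_mono) auto
    then have "overlap p n (f (observation p n G \<pi>)) \<pi> \<le> real (agreement f p n G \<pi>) / real n"
      unfolding overlap_def by (intro divide_right_mono of_nat_mono) auto
    then have "d \<le> real (agreement f p n G \<pi>) / real n"
      using ov by linarith
    then have "1 \<le> real (agreement f p n G \<pi>) / (real n * d)"
      using d n by (simp add: field_simps)
    then have "pmf ?M (G, \<pi>) * 1 \<le> pmf ?M (G, \<pi>) * (real (agreement f p n G \<pi>) / (real n * d))"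
      by (intro mult_left_mono) auto
    then show "pmf ?M (G, \<pi>) \<le> pmf ?M (G, \<pi>) * real (agreement f p n G \<pi>) / (real n * d)"
      by simp
  qed
  also have "\<dots> \<le> (\<Sum>(G, \<pi>)\<in>?X. pmf ?M (G, \<pi>) * real (agreement f p n G \<pi>) / (real n * d))"
    using d by (intro sum_mono2) auto
  finally show ?thesis
    by (simp add: sum_divide_distrib case_prod_unfold)
qed

lemma prob_overlap_tendsto_0:
  fixes est :: "nat \<Rightarrow> (nat \<Rightarrow> nat set \<Rightarrow> bool) \<Rightarrow> nat \<Rightarrow> nat \<Rightarrow> nat"
  assumes p: "p \<ge> 2" and lam: "lam > 0" and s: "0 \<le> s" "s \<le> 1"
    and sub: "lam * s * (1 - (1 - s) ^ (p - 1)) < 1" and d: "0 < d"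
  shows "(\<lambda>n. measure_pmf.prob (alignment_model p n lam s)
      {(G, \<pi>). d \<le> overlap p n (est n (observation p n G \<pi>)) \<pi>}) \<longlonglongrightarrow> 0"
proof (rule LIMSEQ_I)
  let ?P = "\<lambda>n. measure_pmf.prob (alignment_model p n lam s)
      {(G, \<pi>). d \<le> overlap p n (est n (observation p n G \<pi>)) \<pi>}"
  define c where "c = 1 - lam * s * (1 - (1 - s) ^ (p - 1))"
  define C where "C = exp (4 * lam\<^sup>2) / d"
  have c: "c > 0" and C: "C > 0"
    using sub d by (auto simp: c_def C_def)
  have bound: "?P n \<le> C * real (card (codes K)) / real n + C / (c * real K)"
    if "n > 0" "2 * lam \<le> real n" "K > 0" for n K
  proof -
    have "?P n \<le> (\<Sum>(G, \<pi>)\<in>observations p n \<times> alignments p n.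
      pmf (alignment_model p n lam s) (G, \<pi>) * real (agreement (est n) p n G \<pi>)) / (real n * d)"
      by (rule prob_overlap_le[OF p that(1) d])
    also have "\<dots> \<le> (exp (4 * lam\<^sup>2) * (real (card (codes K)) + real n / (real K * c))) / (real n * d)"
      unfolding c_def using d
      by (intro divide_right_mono expected_agreement_bound lam s p sub that) auto
    also have "\<dots> = C * real (card (codes K)) / real n + C / (c * real K)"
      using that d c by (simp add: C_def field_simps)
    finally show ?thesis .
  qed
  fix \<epsilon> :: real assume \<epsilon>: "0 < \<epsilon>"
  \<comment> \<open>\<open>K\<close> is fixed first, to make the large-component term less than
    \<open>\<epsilon> / 2\<close>; only then is \<open>n\<close> taken large compared with the
    number of codes for this \<open>K\<close>.\<close>
  obtain K :: nat where K: "2 * C / (c * \<epsilon>) < real K"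
    using reals_Archimedean2 by blast
  have "0 < 2 * C / (c * \<epsilon>)"
    using \<epsilon> c C by simp
  then have K0: "K > 0"
    using K by (metis gr0I less_trans of_nat_0 order_less_irrefl)
  have K2: "C / (c * real K) < \<epsilon> / 2"
    using K K0 c \<epsilon> by (simp add: field_simps)
  obtain N :: nat where N: "2 * lam + 2 * C * real (card (codes K)) / \<epsilon> + 1 < real N"
    using reals_Archimedean2 by blast
  have "norm (?P n - 0) < \<epsilon>" if n: "n \<ge> N" for n
  proof -
    have *: "2 * lam + 2 * C * real (card (codes K)) / \<epsilon> + 1 < real n"
      using N n by (meson less_le_trans of_nat_mono)
    have nn: "0 \<le> 2 * C * real (card (codes K)) / \<epsilon>"
      using C \<epsilon> by simp
    have n0: "0 < n" "2 * lam \<le> real n" and "2 * C * real (card (codes K)) / \<epsilon> < real n"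
      using * nn lam by (auto intro!: Nat.gr0I)
    then have "C * real (card (codes K)) / real n < \<epsilon> / 2"
      using \<epsilon> by (simp add: field_simps)
    then have "?P n < \<epsilon>"
      using bound[OF n0 K0] K2 by linarith
    then show ?thesis
      by simp
  qed
  then show "\<exists>N. \<forall>n\<ge>N. norm (?P n - 0) < \<epsilon>"
    by blast
qed

theorem theorem1p2:
  fixes p :: nat and lam s r :: real
    and est :: "nat \<Rightarrow> (nat \<Rightarrow> nat set \<Rightarrow> bool) \<Rightarrow> (nat \<Rightarrow> nat \<Rightarrow> nat)"
  assumes "p \<ge> 2" and "lam > 0" and "0 < s" and "s < 1"
    and "lam * s * (1 - (1 - s) ^ (p - 1)) < 1"
    and "0 \<le> r" and "r < 1"
    and "\<And>n. n \<ge> 1 \<Longrightarrow> est n \<in> estimators p n"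
  shows "(\<lambda>n. measure_pmf.prob (alignment_model p n lam s)
            {(G, \<pi>). 1 - overlap p n (est n (observation p n G \<pi>)) \<pi> > r}) \<longlonglongrightarrow> 1"
proof -
  \<comment> \<open>The complementary event is an overlap of at least \<open>1 - r\<close>, a
    threshold that is positive because \<open>r < 1\<close>.\<close>
  let ?bad = "\<lambda>n. {(G, \<pi>). 1 - r \<le> overlap p n (est n (observation p n G \<pi>)) \<pi>}"
  have "{(G, \<pi>). 1 - overlap p n (est n (observation p n G \<pi>)) \<pi> > r} = UNIV - ?bad n" for n
    by auto
  then have "measure_pmf.prob (alignment_model p n lam s)
      {(G, \<pi>). 1 - overlap p n (est n (observation p n G \<pi>)) \<pi> > r} =
      1 - measure_pmf.prob (alignment_model p n lam s) (?bad n)" for n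
    using measure_pmf.prob_compl[of "?bad n" "alignment_model p n lam s"] by simp
  moreover have "(\<lambda>n. 1 - measure_pmf.prob (alignment_model p n lam s) (?bad n)) \<longlonglongrightarrow> 1 - 0"
    using assms by (intro tendsto_diff tendsto_const prob_overlap_tendsto_0) auto
  ultimately show ?thesis
    by simp
qed

end
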